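(* Under the standing setting, if $f_0=f_\infty=0$, then there exist $\lambda_*\in(0,\infty)$ and $m_*\in(0,\infty)$ such that: for every $\lambda\in(\lambda_*,\infty)$ problem (P$_\lambda$) has two positive solutions $u_1(\lambda),u_2(\lambda)$ with $0<\|u_1(\lambda)\|_\infty<m_*<\|u_2(\lambda)\|_\infty$, which can be chosen so that $\lim_{\lambda\to\infty}\|u_1(\lambda)\|_\infty=0$ and $\lim_{\lambda\to\infty}\|u_2(\lambda)\|_\infty=\infty$; and problem (P$_{\lambda_*}$) has a positive solution.
   Context: Standing setting. $\varphi:\mathbb{R}\to\mathbb{R}$ is an odd, increasing homeomorphism satisfying condition (A): there exist increasing homeomorphisms $\psi_1,\psi_2:[0,\infty)\to[0,\infty)$ such that $\varphi(x)\psi_1(y)\le \varphi(xy)\le \varphi(x)\psi_2(y)$ for all $x,y\ge 0$. Let $c,d\in C([0,1],(0,\infty))$, and $\|\cdot\|_\infty$ the maximum norm on $C[0,1]$. Let $f\in C([0,\infty),[0,\infty))$ with $f(s)>0$ for $s>0$, and write $f_0=\lim_{s\to0^+}f(s)/\varphi(s)$, $f_\infty=\lim_{s\to\infty}f(s)/\varphi(s)$ (assumed to exist in $[0,\infty]$ whenever referred to). Let $h\in C((0,1),[0,\infty))$, $h\not\equiv 0$, with $\int_0^{1/2}\psi_1^{-1}\big(\int_s^{1/2}h(\tau)d\tau\big)ds+\int_{1/2}^1\psi_1^{-1}\big(\int_{1/2}^s h(\tau)d\tau\big)ds<\infty$. Notation attached to $h$: $\alpha_h=\sup\{x\in(0,1):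 h=0 \text{ on }(0,x)\}$ ($0$ if empty); $\beta_h=\inf\{x\in(0,1): h=0\text{ on }(x,1)\}$ ($1$ if empty); $\bar\alpha_h=\sup\{x\in(\alpha_h,1]: h>0 \text{ on }(\alpha_h,x)\}$; $\bar\beta_h=\inf\{x\in[0,\beta_h): h>0\text{ on }(x,\beta_h)\}$; $\gamma_h^1=(3\alpha_h+\bar\alpha_h)/4$, $\gamma_h^2=(\bar\beta_h+3\beta_h)/4$. It is assumed that $0\le\alpha_h<\gamma_h^1<\gamma_h^2<\beta_h\le 1$. For $\lambda\ge0$, problem (P$_\lambda$) is: $(d(t)\varphi(c(t)u'(t)))'+\lambda h(t)f(u(t))=0$ for $t\in(0,1)$, $u(0)=u(1)=0$. A solution is $u\in C[0,1]\cap C^1(0,1)$ such that $t\mapsto d(t)\varphi(c(t)u'(t))$ is continuously differentiable on $(0,1)$ and the equation and boundary conditions hold; it is positive if $u(t)>0$ for all $t\in(0,1)$. *)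

theory Defs
  imports "HOL-Analysis.Analysis"
begin

definition inc_homeo_nonneg :: "(real \<Rightarrow> real) \<Rightarrow> bool" where
  "inc_homeo_nonneg \<psi> \<longleftrightarrow> strict_mono_on {0..} \<psi> \<and> continuous_on {0..} \<psi> \<and> \<psi> ` {0..} = {0..}"

definition phi_condA :: "(real \<Rightarrow> real) \<Rightarrow> (real \<Rightarrow> real) \<Rightarrow> (real \<Rightarrow> real) \<Rightarrow> bool" where
  "phi_condA \<phi> \<psi>1 \<psi>2 \<longleftrightarrow>
     (\<forall>x. \<phi> (-x) = - \<phi> x) \<and> strict_mono \<phi> \<and> continuous_on UNIV \<phi> \<and> surj \<phi> \<and>
     inc_homeo_nonneg \<psi>1 \<and> inc_homeo_nonneg \<psi>2 \<and>
     (\<forall>x\<ge>0. \<forall>y\<ge>0. \<phi> x * \<psi>1 y \<le> \<phi> (x * y) \<and> \<phi> (x * y) \<le> \<phi> x * \<psi>2 y)"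

definition h_integrability :: "(real \<Rightarrow> real) \<Rightarrow> (real \<Rightarrow> real) \<Rightarrow> bool" where
  "h_integrability \<psi>1 h \<longleftrightarrow>
     (\<integral>\<^sup>+ s. ennreal (the_inv_into {0..} \<psi>1 (integral {s..1/2} h)) * indicator {0<..<1/2} s \<partial>lborel)
   + (\<integral>\<^sup>+ s. ennreal (the_inv_into {0..} \<psi>1 (integral {1/2..s} h)) * indicator {1/2<..<1} s \<partial>lborel)
   < \<infinity>"

definition alpha_h :: "(real \<Rightarrow> real) \<Rightarrow> real" where
  "alpha_h h = (let S = {x\<in>{0<..<1}. \<forall>t\<in>{0<..<x}. h t = 0} in if S = {} then 0 else Sup S)"

definition beta_h :: "(real \<Rightarrow> real) \<Rightarrow> real" where
  "beta_h h = (let S = {x\<in>{0<..<1}. \<forall>t\<in>{x<..<1}. h t = 0} in if S = {} then 1 else Inf S)"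

text \<open>If the defining set is empty we take alpha_h (resp. beta_h); this forces gamma to
  coincide with alpha (resp. beta), which the standing assumption then excludes.\<close>
definition alpha_bar_h :: "(real \<Rightarrow> real) \<Rightarrow> real" where
  "alpha_bar_h h = (let S = {x\<in>{alpha_h h<..1}. \<forall>t\<in>{alpha_h h<..<x}. h t > 0}
                    in if S = {} then alpha_h h else Sup S)"

definition beta_bar_h :: "(real \<Rightarrow> real) \<Rightarrow> real" where
  "beta_bar_h h = (let S = {x\<in>{0..<beta_h h}. \<forall>t\<in>{x<..<beta_h h}. h t > 0}
                   in if S = {} then beta_h h else Inf S)"

definition gamma1_h :: "(real \<Rightarrow> real) \<Rightarrow> real" where
  "gamma1_h h = (3 * alpha_h h + alpha_bar_h h) / 4"

definition gamma2_h :: "(real \<Rightarrow> real) \<Rightarrow> real" where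
  "gamma2_h h = (beta_bar_h h + 3 * beta_h h) / 4"

definition supnorm :: "(real \<Rightarrow> real) \<Rightarrow> real" where
  "supnorm u = (SUP t\<in>{0..1}. \<bar>u t\<bar>)"

definition is_solution ::
  "(real \<Rightarrow> real) \<Rightarrow> (real \<Rightarrow> real) \<Rightarrow> (real \<Rightarrow> real) \<Rightarrow> (real \<Rightarrow> real) \<Rightarrow> (real \<Rightarrow> real)
    \<Rightarrow> real \<Rightarrow> (real \<Rightarrow> real) \<Rightarrow> bool" where
  "is_solution \<phi> c d h f lam u \<longleftrightarrow>
     continuous_on {0..1} u \<and>
     (\<exists>u' w'.
        (\<forall>t\<in>{0<..<1}. (u has_real_derivative u' t) (at t)) \<and> continuous_on {0<..<1} u' \<and>
        (\<forall>t\<in>{0<..<1}. ((\<lambda>s. d s * \<phi> (c s * u' s)) has_real_derivative w' t) (at t)) \<and>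
        continuous_on {0<..<1} w' \<and>
        (\<forall>t\<in>{0<..<1}. w' t + lam * h t * f (u t) = 0)) \<and>
     u 0 = 0 \<and> u 1 = 0"

definition is_pos_solution ::
  "(real \<Rightarrow> real) \<Rightarrow> (real \<Rightarrow> real) \<Rightarrow> (real \<Rightarrow> real) \<Rightarrow> (real \<Rightarrow> real) \<Rightarrow> (real \<Rightarrow> real)
    \<Rightarrow> real \<Rightarrow> (real \<Rightarrow> real) \<Rightarrow> bool" where
  "is_pos_solution \<phi> c d h f lam u \<longleftrightarrow> is_solution \<phi> c d h f lam u \<and> (\<forall>t\<in>{0<..<1}. u t > 0)"

end

theory Submission
  imports Defs "HOL-Complex_Analysis.Great_Picard"
begin

text \<open>
  Write \<open>a t v\<close> for \<open>\<phi>\<^sup>-\<^sup>1 (v / d t) / c t\<close>. The Dirichlet problem with right-hand side \<open>- h k\<close> has the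
  solution \<open>T k t = \<integral>\<^sub>0\<^sup>t a s (\<kappa> - \<integral>\<^sub>1\<^sub>/\<^sub>2\<^sup>s h k)\<close>, where \<open>\<kappa>\<close> is the unique constant with \<open>T k 1 = 0\<close>.
  The flux is decreasing, so \<open>T k\<close> rises and then falls, and condition (A) bounds it from below by
  \<open>const * min t (1 - t) * \<parallel>T k\<parallel>\<close>. Hence a positive solution of norm \<open>m\<close> is \<open>m * w\<close> with
  \<open>const * min t (1 - t) \<le> w t \<le> 1\<close> and \<open>T (\<lambda> f (m w)) = m w\<close>. Iterating
  \<open>w \<mapsto> T (\<lambda> f (m w)) / \<parallel>T (\<lambda> f (m w))\<parallel>\<close> and moving \<open>m\<close> up or down by \<open>\<parallel>T (\<lambda> f (m w))\<parallel> - m\<close> (clamped to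
  \<open>[r, R]\<close>) is a compact self-map of a box of functions, so Schauder's theorem yields a solution with norm in
  \<open>(r, R)\<close> as soon as \<open>\<parallel>T (\<lambda> f (m w))\<parallel> - m\<close> has opposite signs at \<open>m = r\<close> and \<open>m = R\<close>; this covers the
  compressive and the expansive case of Krasnoselskii's theorem at once. For small and for large \<open>m\<close>
  the sign is negative because \<open>f\<^sub>0 = f\<^sub>\<infinity> = 0\<close>, and at any prescribed \<open>m = \<rho>\<close> it is positive once \<open>\<lambda>\<close> is
  large. So one may take \<open>m\<^sub>* = 1\<close> and any sufficiently large \<open>\<lambda>\<^sub>*\<close>; letting \<open>\<rho>\<close> tend to \<open>0\<close> or \<open>\<infinity>\<close> and choosing
  solutions of almost extremal norm gives the limits.
\<close>

subsection \<open>Fixed points of compact maps on unit-interval-valued functions\<close>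

text \<open>Bolzano-Weierstrass, refining the subsequence one coordinate at a time. Points are
  sequences of which only the indices below \<open>n\<close> count, so that the dimension is a
  number that may depend on the data, not a type.\<close>

lemma unit_cube_convergent_subsequence:
  fixes X :: "nat \<Rightarrow> nat \<Rightarrow> real"
  assumes "\<And>p. \<forall>j<n. X p j \<in> {0..1}"
  obtains r x where "strict_mono r" "\<forall>j<n. x j \<in> {0..1}" "\<forall>j<n. (\<lambda>p. X (r p) j) \<longlonglongrightarrow> x j"
proof -
  have "\<exists>r x. strict_mono r \<and> (\<forall>j<n. x j \<in> {0..1}) \<and> (\<forall>j<n. (\<lambda>p. X (r p) j) \<longlonglongrightarrow> x j)"
    using assms
  proof (induction n)
    case 0
    show ?case using strict_mono_id by auto
  next
    case (Suc n)
    have "\<forall>j<n. X p j \<in> {0..1}" for p using Suc.prems less_SucI by blast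
    from Suc.IH[OF this] obtain r x where r: "strict_mono r" and x: "\<forall>j<n. x j \<in> {0..1}"
      and lim: "\<forall>j<n. (\<lambda>p. X (r p) j) \<longlonglongrightarrow> x j"
      by blast
    have "\<forall>p. X (r p) n \<in> {0..1}" using Suc.prems by blast
    then obtain l r' where l: "l \<in> {0..1}" and r': "strict_mono r'"
      and lim': "((\<lambda>p. X (r p) n) \<circ> r') \<longlonglongrightarrow> l"
      using seq_compactE[OF compact_imp_seq_compact[OF compact_Icc[of 0 "1::real"]], of "\<lambda>p. X (r p) n"]
      by blast
    have "(\<lambda>p. X ((r \<circ> r') p) j) \<longlonglongrightarrow> (x(n := l)) j" if "j < Suc n" for j
    proof (cases "j = n")
      case True
      then show ?thesis using lim' by (simp add: o_def)
    next
      case False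
      then have "(\<lambda>p. X (r p) j) \<longlonglongrightarrow> x j" using lim that by simp
      from LIMSEQ_subseq_LIMSEQ[OF this r'] show ?thesis using False by (simp add: o_def)
    qed
    moreover have "\<forall>j<Suc n. (x(n := l)) j \<in> {0..1}" using x l by (simp add: less_Suc_eq)
    ultimately show ?case using strict_mono_o[OF r r'] by blast
  qed
  then show ?thesis using that by blast
qed

text \<open>Brouwer's theorem in a variable dimension, needed because the approximation below
  chooses the number of nodes. On ever finer grids Kuhn's lemma supplies, close to one point and for
  every coordinate, a point where \<open>G\<close> does not decrease that coordinate and a point
  where it does not increase it; a limit of such points is fixed.\<close>

lemma brouwer_nat_cube:
  fixes G :: "(nat \<Rightarrow> real) \<Rightarrow> nat \<Rightarrow> real"
  assumes maps: "\<And>x i. \<forall>j<n. x j \<in> {0..1} \<Longrightarrow> i < n \<Longrightarrow> G x i \<in> {0..1}"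
    and cont: "\<And>X x i. (\<And>p. \<forall>j<n. X p j \<in> {0..1}) \<Longrightarrow> \<forall>j<n. x j \<in> {0..1} \<Longrightarrow>
        \<forall>j<n. (\<lambda>p. X p j) \<longlonglongrightarrow> x j \<Longrightarrow> i < n \<Longrightarrow> (\<lambda>p. G (X p) i) \<longlonglongrightarrow> G x i"
  obtains x where "\<forall>j<n. x j \<in> {0..1}" "\<forall>i<n. G x i = x i"
proof -
  define near where "near p x y \<longleftrightarrow> (\<forall>j<n. y j \<in> {0..1} \<and> \<bar>y j - x j\<bar> \<le> 1 / real (Suc p))"
    for p and x y :: "nat \<Rightarrow> real"
  have "\<exists>x::nat \<Rightarrow> real. (\<forall>j<n. x j \<in> {0..1}) \<and>
      (\<forall>i<n. \<exists>a b. near p x a \<and> near p x b \<and> a i \<le> G a i \<and> G b i \<le> b i)" for p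
  proof -
    define pt where "pt z = (\<lambda>j. real (z j) / real (Suc p))" for z :: "nat \<Rightarrow> nat"
    \<comment> \<open>Label 0 records that coordinate \<open>i\<close> is not decreased by
      \<open>G\<close>, label 1 that it is not increased. The first two cases prescribe the labels
      on the faces as Kuhn's lemma requires, and agree with this reading because \<open>G\<close>
      stays in the cube.\<close>
    define label where "label z i = (if z i = 0 then 0 else if z i = Suc p then 1
        else if pt z i \<le> G (pt z) i then 0 else (1::nat))" for z i
    have pt: "\<forall>j<n. pt z j \<in> {0..1}" if "\<forall>j<n. z j \<le> Suc p" for z
      using that by (auto simp: pt_def divide_simps)
    have label01: "label z i = 0 \<or> label z i = 1" for z i
      by (simp add: label_def)
    have label0: "pt z i \<le> G (pt z) i" if "label z i = 0" "i < n" "\<forall>j<n. z j \<le> Suc p" for z i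
      using that maps[OF pt[OF that(3)] that(2)]
      by (auto simp: label_def pt_def split: if_splits)
    have label1: "G (pt z) i \<le> pt z i" if "label z i = 1" "i < n" "\<forall>j<n. z j \<le> Suc p" for z i
      using that maps[OF pt[OF that(3)] that(2)]
      by (auto simp: label_def pt_def split: if_splits)
    obtain q where q: "\<forall>i<n. q i < Suc p"
      and rs: "\<forall>i<n. \<exists>r s. (\<forall>j<n. q j \<le> r j \<and> r j \<le> q j + 1) \<and>
                 (\<forall>j<n. q j \<le> s j \<and> s j \<le> q j + 1) \<and> label r i \<noteq> label s i"
      by (rule kuhn_lemma[of "Suc p" n label]) (auto simp: label_def)
    have near: "near p (pt q) (pt r)" "\<forall>j<n. r j \<le> Suc p"
      if "\<forall>j<n. q j \<le> r j \<and> r j \<le> q j + 1" for r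
    proof -
      show le: "\<forall>j<n. r j \<le> Suc p" using that q by fastforce
      have "\<bar>pt r j - pt q j\<bar> \<le> 1 / real (Suc p)" if "j < n" for j
      proof -
        have "\<bar>real (r j) - real (q j)\<bar> \<le> 1"
          using \<open>\<forall>j<n. q j \<le> r j \<and> r j \<le> q j + 1\<close> \<open>j < n\<close> by fastforce
        moreover have "\<bar>pt r j - pt q j\<bar> = \<bar>real (r j) - real (q j)\<bar> / real (Suc p)"
          unfolding pt_def by (simp flip: diff_divide_distrib)
        ultimately show ?thesis by (simp add: divide_right_mono)
      qed
      then show "near p (pt q) (pt r)" using pt[OF le] unfolding near_def by blast
    qed
    have "\<exists>a b. near p (pt q) a \<and> near p (pt q) b \<and> a i \<le> G a i \<and> G b i \<le> b i" if i: "i < n" for i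
    proof -
      obtain r s where r: "\<forall>j<n. q j \<le> r j \<and> r j \<le> q j + 1"
        and s: "\<forall>j<n. q j \<le> s j \<and> s j \<le> q j + 1" and ne: "label r i \<noteq> label s i"
        using rs i by blast
      consider "label r i = 0" "label s i = 1" | "label r i = 1" "label s i = 0"
        using ne label01[of r i] label01[of s i] by auto
      then show ?thesis
      proof cases
        case 1
        then show ?thesis
          using near[OF r] near[OF s] label0[of r i] label1[of s i] i
          by (intro exI[of _ "pt r"] exI[of _ "pt s"]) simp
      next
        case 2
        then show ?thesis
          using near[OF r] near[OF s] label0[of s i] label1[of r i] i
          by (intro exI[of _ "pt s"] exI[of _ "pt r"]) simp
      qed
    qed
    moreover have "\<forall>j<n. pt q j \<in> {0..1}" using pt q by (simp add: less_imp_le)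
    ultimately show ?thesis by blast
  qed
  then obtain X where X: "\<And>p. \<forall>j<n. X p j \<in> {0..1}"
    and ab: "\<And>p. \<forall>i<n. \<exists>a b. near p (X p) a \<and> near p (X p) b \<and> a i \<le> G a i \<and> G b i \<le> b i"
    by metis
  \<comment> \<open>The two witnesses depend on the coordinate, so they are chosen for each
    \<open>i\<close> separately. All of them stay within \<open>1 / real (Suc p)\<close> of
    \<open>X p\<close> in every coordinate and therefore share its limit.\<close>
  define A where "A p i = (SOME a. near p (X p) a \<and> a i \<le> G a i)" for p i
  define B where "B p i = (SOME b. near p (X p) b \<and> G b i \<le> b i)" for p i
  have A: "near p (X p) (A p i) \<and> A p i i \<le> G (A p i) i" if "i < n" for p i
  proof -
    have "\<exists>a. near p (X p) a \<and> a i \<le> G a i" using ab[of p, rule_format, OF that] by (elim exE conjE) (rule exI, rule conjI)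
    from someI_ex[OF this] show ?thesis unfolding A_def .
  qed
  have B: "near p (X p) (B p i) \<and> G (B p i) i \<le> B p i i" if "i < n" for p i
  proof -
    have "\<exists>b. near p (X p) b \<and> G b i \<le> b i" using ab[of p, rule_format, OF that] by (elim exE conjE) (rule exI, rule conjI)
    from someI_ex[OF this] show ?thesis unfolding B_def .
  qed
  obtain r x where r: "strict_mono r" and x: "\<forall>j<n. x j \<in> {0..1}"
    and lim: "\<forall>j<n. (\<lambda>p. X (r p) j) \<longlonglongrightarrow> x j"
    by (rule unit_cube_convergent_subsequence[OF X])
  have near_lim: "(\<lambda>p. Y p j) \<longlonglongrightarrow> x j"
    if Y: "\<And>p. near (r p) (X (r p)) (Y p)" and j: "j < n" for Y j
  proof -
    have "(\<lambda>p. Y p j - X (r p) j) \<longlonglongrightarrow> 0"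
    proof (rule Lim_null_comparison)
      show "\<forall>\<^sub>F p in sequentially. norm (Y p j - X (r p) j) \<le> 1 / real (Suc (r p))"
        using Y j by (simp add: near_def)
      show "(\<lambda>p. 1 / real (Suc (r p))) \<longlonglongrightarrow> 0"
        using LIMSEQ_subseq_LIMSEQ[OF lim_inverse_n' r, THEN LIMSEQ_Suc]
          LIMSEQ_subseq_LIMSEQ[OF LIMSEQ_inverse_real_of_nat r]
        by (simp add: o_def inverse_eq_divide)
    qed
    from tendsto_add[OF this lim[rule_format, OF j]] show ?thesis by simp
  qed
  have "G x i = x i" if i: "i < n" for i
  proof (rule antisym)
    have nA: "near (r p) (X (r p)) (A (r p) i)" and nB: "near (r p) (X (r p)) (B (r p) i)"
      for p using A B i by auto
    have GA: "(\<lambda>p. G (A (r p) i) i) \<longlonglongrightarrow> G x i"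
      by (rule cont) (use x i near_lim[OF nA] nA near_def in auto)
    have GB: "(\<lambda>p. G (B (r p) i) i) \<longlonglongrightarrow> G x i"
      by (rule cont) (use x i near_lim[OF nB] nB near_def in auto)
    show "G x i \<le> x i"
      by (rule LIMSEQ_le[OF GB near_lim[OF nB i]]) (use A B i in auto)
    show "x i \<le> G x i"
      by (rule LIMSEQ_le[OF near_lim[OF nA i] GA]) (use A B i in auto)
  qed
  then show ?thesis using that x by blast
qed

definition unit_functions :: "'a::topological_space set \<Rightarrow> ('a \<Rightarrow> real) set" where
  "unit_functions S = {u. continuous_on S u \<and> (\<forall>t\<in>S. u t \<in> {0..1})}"

text \<open>The finite-dimensional reduction discretises the domain: a function is replaced by its
  values at a \<open>\<delta>\<close>-net, interpolated by a partition of unity. Brouwer's theorem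
  fixes the values at the nodes, and equicontinuity of the image controls the error between
  them.\<close>

lemma schauder_approximate:
  fixes F :: "('a::metric_space \<Rightarrow> real) \<Rightarrow> 'a \<Rightarrow> real"
  assumes S: "compact S"
    and maps: "\<And>u. u \<in> unit_functions S \<Longrightarrow> F u \<in> unit_functions S"
    and cont: "\<And>U u t. (\<And>n. U n \<in> unit_functions S) \<Longrightarrow> u \<in> unit_functions S \<Longrightarrow>
        uniform_limit S U u sequentially \<Longrightarrow> t \<in> S \<Longrightarrow> (\<lambda>n. F (U n) t) \<longlonglongrightarrow> F u t"
    and \<delta>: "\<delta> > 0"
    and equi: "\<And>u s t. u \<in> unit_functions S \<Longrightarrow> s \<in> S \<Longrightarrow> t \<in> S \<Longrightarrow> dist s t < \<delta> \<Longrightarrow>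
        \<bar>F u s - F u t\<bar> \<le> e"
  obtains u where "u \<in> unit_functions S" "\<forall>t\<in>S. \<bar>F u t - u t\<bar> \<le> e"
proof -
  obtain D where D: "finite D" "D \<subseteq> S" "S \<subseteq> (\<Union>x\<in>D. ball x \<delta>)"
    using compactE_image[OF S, of S "\<lambda>x. ball x \<delta>"] \<delta> by (metis UN_I centre_in_ball open_ball subsetI)
  obtain n and d :: "nat \<Rightarrow> 'a" where d: "D = d ` {..<n}"
    using finite_imp_nat_seg_image_inj_on[OF D(1)] by (auto simp: lessThan_def)
  \<comment> \<open>Hat functions supported near the nodes. Their sum is positive on
    \<open>S\<close> because the balls cover it, so the quotients \<open>w\<close> form a partition
    of unity there.\<close>
  define b where "b i t = max 0 (\<delta> - dist t (d i))" for i t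
  define w where "w i t = b i t / (\<Sum>j<n. b j t)" for i t
  have b0: "b i t \<ge> 0" for i t by (simp add: b_def)
  have pos: "(\<Sum>j<n. b j t) > 0" if "t \<in> S" for t
  proof -
    have "t \<in> (\<Union>x\<in>D. ball x \<delta>)" using D(3) that by blast
    then obtain j where "j < n" "dist (d j) t < \<delta>" using d by auto
    then show ?thesis
      by (intro sum_pos2[of _ j]) (auto simp: b_def dist_commute)
  qed
  have w0: "w i t \<ge> 0" if "t \<in> S" for i t
    using b0 pos[OF that] by (simp add: w_def)
  have w1: "(\<Sum>i<n. w i t) = 1" if "t \<in> S" for t
    using pos[OF that] by (simp add: w_def flip: sum_divide_distrib)
  have w_cont: "continuous_on S (w i)" for i
    unfolding w_def b_def
    by (intro continuous_intros) (use pos in \<open>force simp: b_def\<close>)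
  define I where "I x t = (\<Sum>i<n. x i * w i t)" for x t
  have I_unit: "I x \<in> unit_functions S" if x: "\<forall>j<n. x j \<in> {0..1}" for x
  proof -
    have "I x t \<in> {0..1}" if t: "t \<in> S" for t
    proof -
      have "I x t \<le> (\<Sum>i<n. 1 * w i t)"
        unfolding I_def using x w0[OF t] by (intro sum_mono mult_right_mono) auto
      moreover have "I x t \<ge> 0"
        unfolding I_def using x w0[OF t] by (intro sum_nonneg) auto
      ultimately show ?thesis using w1[OF t] by simp
    qed
    moreover have "continuous_on S (I x)"
      unfolding I_def by (intro continuous_intros w_cont)
    ultimately show ?thesis by (simp add: unit_functions_def)
  qed
  have I_lim: "uniform_limit S (\<lambda>p. I (X p)) (I x) sequentially"
    if lim: "\<forall>j<n. (\<lambda>p. X p j) \<longlonglongrightarrow> x j" for X x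
  proof (rule uniform_limitI)
    fix \<epsilon> :: real assume "\<epsilon> > 0"
    have "(\<lambda>p. \<Sum>i<n. \<bar>X p i - x i\<bar>) \<longlonglongrightarrow> (\<Sum>i<n. \<bar>x i - x i\<bar>)"
      using lim by (intro tendsto_intros) auto
    then have "\<forall>\<^sub>F p in sequentially. (\<Sum>i<n. \<bar>X p i - x i\<bar>) < \<epsilon>"
      using \<open>\<epsilon> > 0\<close> by (intro order_tendstoD) auto
    then show "\<forall>\<^sub>F p in sequentially. \<forall>t\<in>S. dist (I (X p) t) (I x t) < \<epsilon>"
    proof eventually_elim
      case (elim p)
      show ?case
      proof
        fix t assume t: "t \<in> S"
        have "\<bar>I (X p) t - I x t\<bar> = \<bar>\<Sum>i<n. (X p i - x i) * w i t\<bar>"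
          unfolding I_def by (simp add: sum_subtractf left_diff_distrib)
        also have "\<dots> \<le> (\<Sum>i<n. \<bar>(X p i - x i) * w i t\<bar>)"
          by (rule sum_abs)
        also have "\<dots> \<le> (\<Sum>i<n. \<bar>X p i - x i\<bar>)"
        proof (rule sum_mono)
          fix i assume "i \<in> {..<n}"
          then have "w i t \<le> (\<Sum>i<n. w i t)"
            using w0[OF t] by (intro member_le_sum) auto
          then have "w i t \<le> 1" using w1[OF t] by simp
          then show "\<bar>(X p i - x i) * w i t\<bar> \<le> \<bar>X p i - x i\<bar>"
            using w0[OF t, of i] by (simp add: abs_mult mult_left_le)
        qed
        finally show "dist (I (X p) t) (I x t) < \<epsilon>"
          using elim by (simp add: dist_real_def)
      qed
    qed
  qed
  have dS: "d i \<in> S" if "i < n" for i using D d that by auto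
  obtain x where x: "\<forall>j<n. x j \<in> {0..1}" and x_fix: "\<forall>i<n. F (I x) (d i) = x i"
  proof (rule brouwer_nat_cube[of n "\<lambda>x i. F (I x) (d i)"])
    show "F (I x) (d i) \<in> {0..1}" if "\<forall>j<n. x j \<in> {0..1}" "i < n" for x i
      using maps[OF I_unit[OF that(1)]] dS[OF that(2)] by (auto simp: unit_functions_def)
    show "(\<lambda>p. F (I (X p)) (d i)) \<longlonglongrightarrow> F (I x) (d i)"
      if "\<And>p. \<forall>j<n. X p j \<in> {0..1}" "\<forall>j<n. x j \<in> {0..1}"
        "\<forall>j<n. (\<lambda>p. X p j) \<longlonglongrightarrow> x j" "i < n" for X x i
      using cont[of "\<lambda>p. I (X p)" "I x" "d i"] I_unit I_lim[OF that(3)] that dS by blast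
  qed blast
  have "\<bar>F (I x) t - I x t\<bar> \<le> e" if t: "t \<in> S" for t
  proof -
    \<comment> \<open>Since the weights sum to one, the error at \<open>t\<close> is an average of
      the differences between \<open>F (I x)\<close> at \<open>t\<close> and at the nodes; nodes at
      distance \<open>\<delta>\<close> or more have weight zero.\<close>
    have "F (I x) t - I x t = (\<Sum>i<n. F (I x) t * w i t) - I x t"
      using w1[OF t] by (simp flip: sum_distrib_left)
    also have "\<dots> = (\<Sum>i<n. (F (I x) t - F (I x) (d i)) * w i t)"
      using x_fix unfolding I_def by (simp add: sum_subtractf left_diff_distrib)
    also have "\<bar>\<dots>\<bar> \<le> (\<Sum>i<n. \<bar>(F (I x) t - F (I x) (d i)) * w i t\<bar>)"
      by (rule sum_abs)
    also have "\<dots> \<le> (\<Sum>i<n. e * w i t)"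
    proof (rule sum_mono)
      fix i assume i: "i \<in> {..<n}"
      show "\<bar>(F (I x) t - F (I x) (d i)) * w i t\<bar> \<le> e * w i t"
      proof (cases "dist t (d i) < \<delta>")
        case True
        then show ?thesis
          using equi[OF I_unit[OF x] t dS True] i w0[OF t, of i]
          by (simp add: abs_mult mult_right_mono)
      next
        case False
        then have "w i t = 0" by (simp add: w_def b_def)
        then show ?thesis by simp
      qed
    qed
    also have "\<dots> = e" using w1[OF t] by (simp flip: sum_distrib_left)
    finally show ?thesis .
  qed
  then show ?thesis using that I_unit[OF x] by blast
qed

text \<open>Approximate fixed points with error tending to zero are taken to the limit.
  Arzela-Ascoli is applied to their images under \<open>F\<close>, because the approximate fixed
  points themselves need not be equicontinuous.\<close>

lemma schauder_unit_functions:
  fixes F :: "('a::euclidean_space \<Rightarrow> real) \<Rightarrow> 'a \<Rightarrow> real"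
  assumes S: "compact S"
    and maps: "\<And>u. u \<in> unit_functions S \<Longrightarrow> F u \<in> unit_functions S"
    and cont: "\<And>U u t. (\<And>n. U n \<in> unit_functions S) \<Longrightarrow> u \<in> unit_functions S \<Longrightarrow>
        uniform_limit S U u sequentially \<Longrightarrow> t \<in> S \<Longrightarrow> (\<lambda>n. F (U n) t) \<longlonglongrightarrow> F u t"
    and equi: "\<And>e. e > 0 \<Longrightarrow> \<exists>\<delta>>0. \<forall>u\<in>unit_functions S. \<forall>s\<in>S. \<forall>t\<in>S.
        dist s t < \<delta> \<longrightarrow> \<bar>F u s - F u t\<bar> < e"
  obtains u where "u \<in> unit_functions S" "\<forall>t\<in>S. F u t = u t"
proof -
  have "\<exists>u. u \<in> unit_functions S \<and> (\<forall>t\<in>S. \<bar>F u t - u t\<bar> \<le> 1 / real (Suc n))" for n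
  proof -
    obtain \<delta> where "\<delta> > 0" and \<delta>: "\<forall>u\<in>unit_functions S. \<forall>s\<in>S. \<forall>t\<in>S.
        dist s t < \<delta> \<longrightarrow> \<bar>F u s - F u t\<bar> < 1 / real (Suc n)"
      using equi[of "1 / real (Suc n)"] by auto
    obtain u where "u \<in> unit_functions S" "\<forall>t\<in>S. \<bar>F u t - u t\<bar> \<le> 1 / real (Suc n)"
    proof (rule schauder_approximate[of S F \<delta> "1 / real (Suc n)"])
      show "\<bar>F u s - F u t\<bar> \<le> 1 / real (Suc n)"
        if "u \<in> unit_functions S" "s \<in> S" "t \<in> S" "dist s t < \<delta>" for u s t
        using \<delta> that by (simp add: less_imp_le)
    qed (use S maps cont \<open>\<delta> > 0\<close> in auto)
    then show ?thesis by blast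
  qed
  then obtain U where U: "\<And>n. U n \<in> unit_functions S"
    and approx: "\<And>n t. t \<in> S \<Longrightarrow> \<bar>F (U n) t - U n t\<bar> \<le> 1 / real (Suc n)"
    by metis
  have FU: "F (U n) \<in> unit_functions S" for n using maps U by blast
  obtain v k where v: "continuous_on S v" and k: "strict_mono (k :: nat \<Rightarrow> nat)"
    and lim: "\<And>e. 0 < e \<Longrightarrow> \<exists>N. \<forall>n t. n \<ge> N \<and> t \<in> S \<longrightarrow> norm (F (U (k n)) t - v t) < e"
  proof (rule Arzela_Ascoli[OF S, of "\<lambda>n. F (U n)" 1])
    show "norm (F (U n) t) \<le> 1" if "t \<in> S" for n t
      using FU[of n] that by (auto simp: unit_functions_def)
    show "\<exists>d>0. \<forall>n y. y \<in> S \<and> norm (t - y) < d \<longrightarrow> norm (F (U n) t - F (U n) y) < e"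
      if "t \<in> S" "e > 0" for t e
      using equi[OF that(2)] U that(1) by (metis dist_norm real_norm_def)
  qed blast
  have lim_F: "uniform_limit S (\<lambda>n. F (U (k n))) v sequentially"
    unfolding uniform_limit_iff eventually_sequentially dist_norm using lim by meson
  have lim_diff: "uniform_limit S (\<lambda>n t. F (U (k n)) t - U (k n) t) (\<lambda>t. 0) sequentially"
  proof (rule uniform_limitI)
    fix e :: real assume "e > 0"
    have "(\<lambda>n. 1 / real (Suc (k n))) \<longlonglongrightarrow> 0"
      using LIMSEQ_subseq_LIMSEQ[OF LIMSEQ_inverse_real_of_nat k]
      by (simp add: o_def inverse_eq_divide)
    then have "\<forall>\<^sub>F n in sequentially. 1 / real (Suc (k n)) < e"
      using \<open>e > 0\<close> by (rule order_tendstoD)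
    then show "\<forall>\<^sub>F n in sequentially. \<forall>t\<in>S. dist (F (U (k n)) t - U (k n) t) 0 < e"
    proof eventually_elim
      case (elim n)
      then show ?case
        using approx[of _ "k n"] by (auto simp: dist_real_def intro: le_less_trans)
    qed
  qed
  \<comment> \<open>The vanishing approximation error carries the uniform convergence from the
    images over to \<open>U\<close>, so that \<open>cont\<close> can be applied along the
    subsequence.\<close>
  have lim_U: "uniform_limit S (\<lambda>n. U (k n)) v sequentially"
    using uniform_limit_minus[OF lim_F lim_diff] by simp
  have "v t \<in> {0..1}" if "t \<in> S" for t
  proof (rule closed_sequentially[OF closed_atLeastAtMost])
    show "(\<lambda>n. F (U (k n)) t) \<longlonglongrightarrow> v t" using tendsto_uniform_limitI[OF lim_F that] .
    show "F (U (k n)) t \<in> {0..1}" for n using FU[of "k n"] that by (auto simp: unit_functions_def)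
  qed
  then have v_unit: "v \<in> unit_functions S" using v by (simp add: unit_functions_def)
  have "F v t = v t" if "t \<in> S" for t
    using LIMSEQ_unique[OF cont[OF U v_unit lim_U that] tendsto_uniform_limitI[OF lim_F that]] .
  then show ?thesis using that v_unit by blast
qed

subsection \<open>Signed primitives\<close>

text \<open>One of the two integrals is over an empty or one-point interval.\<close>
definition prim :: "(real \<Rightarrow> real) \<Rightarrow> real \<Rightarrow> real" where
  "prim g t = integral {1/2..t} g - integral {t..1/2} g"

lemma continuous_integrable_subinterval:
  fixes g :: "real \<Rightarrow> real"
  assumes "continuous_on {0<..<1} g" "0 < s" "t < 1"
  shows "g integrable_on {s..t}"
  by (rule integrable_continuous_real, rule continuous_on_subset[OF assms(1)]) (use assms in auto)

text \<open>Moving the base point from 1/2 to some \<open>b\<close> left of it gives a single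
  formula on both sides of 1/2, to which the fundamental theorem of calculus applies.\<close>

lemma prim_eq:
  assumes g: "continuous_on {0<..<1} g" and b: "0 < b" "b \<le> 1/2" "b \<le> t" "t < 1"
  shows "prim g t = integral {b..t} g - integral {b..1/2} g"
proof (cases "t \<le> 1/2")
  case True
  have "integral {b..t} g + integral {t..1/2} g = integral {b..1/2} g"
    by (rule Henstock_Kurzweil_Integration.integral_combine)
      (use b True continuous_integrable_subinterval[OF g] in auto)
  moreover have "integral {1/2..t} g = 0"
    using True integral_empty[of g] integral_singleton[of "1/2" g]
    by (metis atLeastatMost_empty atLeastAtMost_singleton order_le_less)
  ultimately show ?thesis by (simp add: prim_def)
next
  case False
  have "integral {b..1/2} g + integral {1/2..t} g = integral {b..t} g"
    by (rule Henstock_Kurzweil_Integration.integral_combine)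
      (use b False continuous_integrable_subinterval[OF g] in auto)
  then show ?thesis using False by (simp add: prim_def)
qed

lemma prim_half [simp]: "prim g (1/2) = 0"
  by (simp add: prim_def)

lemma prim_has_real_derivative:
  assumes g: "continuous_on {0<..<1} g" and t: "t \<in> {0<..<1}"
  shows "(prim g has_real_derivative g t) (at t)"
proof -
  \<comment> \<open>Lying left of both \<open>t\<close> and 1/2, this one base point makes
    \<open>prim_eq\<close> valid in a whole neighbourhood of \<open>t\<close>.\<close>
  define b where "b = min t (1/2) / 2"
  define e where "e = (t + 1) / 2"
  have b: "0 < b" "b < t" "b < 1/2" and e: "t < e" "e < 1" using t by (auto simp: b_def e_def)
  have "continuous_on {b..e} g"
    by (rule continuous_on_subset[OF g]) (use b e in auto)
  then have "((\<lambda>s. integral {b..s} g) has_real_derivative g t) (at t within {b..e})"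
    by (rule integral_has_real_derivative) (use b e in auto)
  then have "((\<lambda>s. integral {b..s} g - integral {b..1/2} g) has_real_derivative g t) (at t within {b..e})"
    by (auto intro!: derivative_eq_intros)
  then have D: "((\<lambda>s. integral {b..s} g - integral {b..1/2} g) has_real_derivative g t) (at t within {b<..<e})"
    by (rule DERIV_subset) auto
  have "(prim g has_real_derivative g t) (at t within {b<..<e})"
    by (rule has_field_derivative_transform_within[OF D zero_less_one])
      (use b e prim_eq[OF g b(1)] in auto)
  then show ?thesis
    using b e by (subst (asm) at_within_open[of t "{b<..<e}"]) auto
qed

lemma prim_continuous_on: "continuous_on {0<..<1} g \<Longrightarrow> continuous_on {0<..<1} (prim g)"
  using prim_has_real_derivative
  by (intro continuous_at_imp_continuous_on) (blast intro: DERIV_isCont)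

text \<open>Values of \<open>prim\<close> compare in opposite directions on the two sides of 1/2.
  Increments do not, and their comparison follows from the sign of a derivative.\<close>

lemma prim_diff_le:
  assumes g: "continuous_on {0<..<1} g" and f: "continuous_on {0<..<1} f"
    and st: "0 < s" "s \<le> t" "t < 1" and le: "\<And>x. s \<le> x \<Longrightarrow> x \<le> t \<Longrightarrow> g x \<le> f x"
  shows "prim g t - prim g s \<le> prim f t - prim f s"
proof -
  have "((\<lambda>x. prim f x - prim g x) has_real_derivative f x - g x) (at x) \<and> f x - g x \<ge> 0"
    if "s \<le> x" "x \<le> t" for x
    using that st le by (auto intro!: derivative_intros prim_has_real_derivative g f)
  then have "prim f s - prim g s \<le> prim f t - prim g t"
    by (intro DERIV_nonneg_imp_nondecreasing[OF st(2)]) blast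
  then show ?thesis by simp
qed

lemma prim_mono:
  assumes g: "continuous_on {0<..<1} g" and "\<And>x. x \<in> {0<..<1} \<Longrightarrow> 0 \<le> g x"
    and st: "0 < s" "s \<le> t" "t < 1"
  shows "prim g s \<le> prim g t"
proof -
  have "prim (\<lambda>_. 0) t - prim (\<lambda>_. 0) s \<le> prim g t - prim g s"
    by (rule prim_diff_le) (use assms in auto)
  then show ?thesis by (simp add: prim_def)
qed

lemma prim_cmult: "prim (\<lambda>s. M * g s) t = M * prim g t"
  by (simp add: prim_def right_diff_distrib)

text \<open>Dominated convergence is used on compact subintervals only, since the majorant
  \<open>h\<close> may fail to be integrable up to 0 or 1.\<close>

lemma prim_tendsto:
  assumes h: "continuous_on {0<..<1} h"
    and g: "\<And>n. continuous_on {0<..<1} (G n)" 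
    and le: "\<And>n x. x \<in> {0<..<1} \<Longrightarrow> \<bar>G n x\<bar> \<le> h x"
    and lim: "\<And>x. x \<in> {0<..<1} \<Longrightarrow> (\<lambda>n. G n x) \<longlonglongrightarrow> g x"
    and t: "t \<in> {0<..<1}"
  shows "(\<lambda>n. prim (G n) t) \<longlonglongrightarrow> prim g t"
proof -
  have "(\<lambda>n. integral {a..b} (G n)) \<longlonglongrightarrow> integral {a..b} g" if "0 < a" "b < 1" for a b
    by (rule dominated_convergence(2)[of _ _ h])
      (use that le lim in \<open>auto intro!: continuous_integrable_subinterval h g\<close>)
  then show ?thesis
    unfolding prim_def using t by (intro tendsto_diff) auto
qed

text \<open>The positive minimum on the middle half bounds the integral from below. This serves both
  strict monotonicity in the constant of integration and the exclusion of a flux of one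
  sign.\<close>

lemma integral_pos_open_unit:
  fixes f :: "real \<Rightarrow> real"
  assumes f: "continuous_on {0<..<1} f" "f integrable_on {0..1}" "\<And>t. t \<in> {0<..<1} \<Longrightarrow> f t > 0"
  shows "integral {0..1} f > 0"
proof -
  have c: "continuous_on {1/4..3/4} f"
    by (rule continuous_on_subset[OF f(1)]) auto
  obtain x where x: "x \<in> {1/4..3/4::real}" "\<And>y. y \<in> {1/4..3/4} \<Longrightarrow> f x \<le> f y"
    using continuous_attains_inf[OF compact_Icc _ c] by auto
  have "0 < f x * (1/2)" using f(3)[of x] x by auto
  also have "f x * (1/2) = integral {1/4..3/4::real} (\<lambda>_. f x)"
    by (simp only: integral_const_real) simp
  also have "\<dots> \<le> integral {1/4..3/4} f"
    by (rule integral_le) (use x c in \<open>auto intro: integrable_continuous_real\<close>)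
  also have "\<dots> \<le> integral {0<..<1} f"
  proof (rule integral_subset_le)
    show "f integrable_on {0<..<1}"
      using f(2) integrable_on_open_interval[of f 0 "1::real"] by simp
  qed (use f(3) in \<open>auto intro: less_imp_le integrable_continuous_real c\<close>)
  also have "\<dots> = integral {0..1} f"
    using integral_open_interval[of 0 "1::real" f] by simp
  finally show ?thesis .
qed

text \<open>The derivative \<open>z\<close> need not be monotone, only comparable to the decreasing function \<open>Y\<close>.\<close>
lemma concave_like_lower_bound:
  fixes y z Y :: "real \<Rightarrow> real"
  assumes A: "0 < A" "A \<le> 1" and y: "continuous_on {0..A} y" "y 0 = 0"
    and deriv: "\<And>t. 0 < t \<Longrightarrow> t < A \<Longrightarrow> (y has_real_derivative z t) (at t)"
    and bounds: "\<And>t. 0 < t \<Longrightarrow> t < A \<Longrightarrow> l * Y t \<le> z t \<and> z t \<le> L * Y t \<and> 0 \<le> Y t"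
    and anti: "\<And>s t. 0 < s \<Longrightarrow> s \<le> t \<Longrightarrow> t < A \<Longrightarrow> Y t \<le> Y s"
    and lL: "0 < l" "l \<le> L" and t: "0 \<le> t" "t \<le> A"
  shows "l / L * t * y A \<le> y t \<and> 0 \<le> y t \<and> y t \<le> y A"
proof -
  have mvt: "\<exists>x. a < x \<and> x < b \<and> y b - y a = (b - a) * z x" if "0 \<le> a" "a < b" "b \<le> A" for a b
  proof -
    have "\<exists>x. a < x \<and> x < b \<and> y b - y a = (\<lambda>u. u * z x) (b - a)"
    proof (rule mvt[OF \<open>a < b\<close>])
      show "continuous_on {a..b} y" by (rule continuous_on_subset[OF y(1)]) (use that in auto)
      show "(y has_derivative (\<lambda>u. u * z x)) (at x)" if "a < x" "x < b" for x
        using deriv[of x] that \<open>0 \<le> a\<close> \<open>b \<le> A\<close>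
        by (simp add: has_field_derivative_def mult_commute_abs)
    qed blast
    then show ?thesis by simp
  qed
  have z0: "0 \<le> z x" if "0 < x" "x < A" for x
    using bounds[OF that] lL by (meson mult_nonneg_nonneg less_imp_le order_trans)
  have mono: "y a \<le> y b" if ab: "0 \<le> a" "a \<le> b" "b \<le> A" for a b
  proof (cases "a = b")
    case False
    then obtain x where "a < x" "x < b" "y b - y a = (b - a) * z x" using mvt[of a b] ab by auto
    moreover have "0 \<le> z x" using z0[of x] ab calculation by auto
    ultimately have "0 \<le> y b - y a" using ab by simp
    then show ?thesis by simp
  qed simp
  have t0: "0 \<le> y t" using mono[of 0 t] y t by simp
  have tA: "y t \<le> y A" using mono[of t A] t by simp
  have "l / L * t * y A \<le> y t"
  proof -
    consider "t = 0" | "t = A" | "0 < t" "t < A" using t by fastforce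
    then show ?thesis
    proof cases
      case 1
      then show ?thesis using y by simp
    next
      case 2
      have "l / L * t \<le> 1 * 1"
        by (rule mult_mono) (use lL A 2 in auto)
      then show ?thesis using t0 2 mult_right_mono[of "l / L * t" 1 "y t"] by simp
    next
      case 3
      \<comment> \<open>Mean value points are taken on either side of \<open>t\<close>. Since
        \<open>Y\<close> decreases, the mean slope before \<open>t\<close> is at least
        \<open>l * Y t\<close> and the mean slope after \<open>t\<close> is at most
        \<open>L * Y t\<close>.\<close>
      obtain x where x: "0 < x" "x < t" "y t = t * z x" using mvt[of 0 t] 3 y by auto
      obtain w where w: "t < w" "w < A" "y A - y t = (A - t) * z w" using mvt[of t A] 3 by auto
      have "l * Y t \<le> l * Y x" using anti[of x t] x 3 lL by simp
      also have "\<dots> \<le> z x" using bounds[of x] x 3 by simp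
      finally have 1: "t * (l * Y t) \<le> y t" using x 3 by simp
      have "z w \<le> L * Y w" using bounds[of w] w 3 by simp
      also have "\<dots> \<le> L * Y t" using anti[of t w] w 3 lL by simp
      finally have 2: "y A - y t \<le> (A - t) * (L * Y t)" using w 3 by simp
      have "l / L * t * y A \<le> l / L * t * (y t + (A - t) * (L * Y t))"
        using 2 lL 3 by (intro mult_left_mono) auto
      also have "\<dots> = l / L * (t * y t) + (A - t) * (t * (l * Y t))"
        using lL by (simp add: field_simps)
      also have "\<dots> \<le> 1 * (t * y t) + (A - t) * y t"
        using 1 3 lL t0 by (intro add_mono mult_right_mono mult_left_mono) auto
      also have "\<dots> = A * y t" by (simp add: algebra_simps)
      also have "\<dots> \<le> y t" using A t0 by (simp add: mult_left_le_one_le)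
      finally show ?thesis .
    qed
  qed
  then show ?thesis using t0 tA by blast
qed

subsection \<open>The solution operator\<close>

text \<open>In the application \<open>q\<close> is the inverse of \<open>\<phi>\<close>,
  \<open>p\<close> is the inverse of \<open>\<psi>1\<close>, and \<open>a t v\<close> recovers the
  derivative of a solution from its flux \<open>v\<close>. \<open>q_mult_le\<close> is condition (A)
  read for the inverses, \<open>l\<close> and \<open>L\<close> absorb the coefficients
  \<open>c\<close> and \<open>d\<close>, and the last assumption is the integrability condition on
  \<open>h\<close>.\<close>

locale bvp_operator =
  fixes a :: "real \<Rightarrow> real \<Rightarrow> real" and q p h :: "real \<Rightarrow> real" and l L :: real
  assumes q_odd: "q (- x) = - q x"
    and q_strict_mono: "strict_mono q"
    and q_unbounded: "\<exists>x. y \<le> q x"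
    and q_mult_le: "0 \<le> x \<Longrightarrow> 0 \<le> y \<Longrightarrow> q (x * y) \<le> q x * p y"
    and p_nonneg: "0 \<le> y \<Longrightarrow> 0 \<le> p y"
    and a_cont: "continuous_on ({0<..<1} \<times> UNIV) (\<lambda>(t, v). a t v)"
    and a_odd: "t \<in> {0<..<1} \<Longrightarrow> a t (- v) = - a t v"
    and a_strict_mono: "t \<in> {0<..<1} \<Longrightarrow> v < w \<Longrightarrow> a t v < a t w"
    and a_bounds: "t \<in> {0<..<1} \<Longrightarrow> 0 \<le> v \<Longrightarrow> l * q v \<le> a t v \<and> a t v \<le> L * q v"
    and l_pos: "0 < l"
    and h_cont: "continuous_on {0<..<1} h"
    and h_nonneg: "t \<in> {0<..<1} \<Longrightarrow> 0 \<le> h t"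
    and p_prim_h_integrable: "(\<lambda>s. p \<bar>prim h s\<bar>) integrable_on {0..1}"
begin

lemma q_0 [simp]: "q 0 = 0"
  using q_odd[of 0] by simp

lemma q_mono: "x \<le> y \<Longrightarrow> q x \<le> q y"
  using q_strict_mono by (simp add: strict_mono_less_eq)

lemma q_nonneg: "0 \<le> x \<Longrightarrow> 0 \<le> q x"
  using q_mono[of 0 x] by simp

lemma q_pos: "0 < x \<Longrightarrow> 0 < q x"
  using q_strict_mono[unfolded strict_mono_def, rule_format, of 0 x] by simp

lemma a_0 [simp]: "t \<in> {0<..<1} \<Longrightarrow> a t 0 = 0"
  using a_odd[of t 0] by simp

lemma a_mono: "t \<in> {0<..<1} \<Longrightarrow> v \<le> w \<Longrightarrow> a t v \<le> a t w"
  using a_strict_mono[of t v w] by (cases "v = w") auto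

lemma l_le_L: "l \<le> L"
proof -
  have "l * q 1 \<le> L * q 1" using a_bounds[of "1/2" 1] by auto
  then show ?thesis using q_pos[of 1] by simp
qed

lemma L_pos: "0 < L" using l_pos l_le_L by simp

text \<open>An integrable majorant of \<open>a t v\<close> for all fluxes with
  \<open>\<bar>v\<bar> \<le> M + M * \<bar>prim h t\<bar>\<close>, hence of every
  \<open>ker k \<kappa>\<close> whose data are bounded by \<open>M\<close>.\<close>

definition dom :: "real \<Rightarrow> real \<Rightarrow> real" where
  "dom M t = L * (q (2 * M) + q (2 * M) * p \<bar>prim h t\<bar>)"

text \<open>The derivative of the candidate solution whose flux at 1/2 equals
  \<open>\<kappa>\<close>.\<close>

definition ker :: "(real \<Rightarrow> real) \<Rightarrow> real \<Rightarrow> real \<Rightarrow> real" where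
  "ker k \<kappa> t = a t (\<kappa> - prim (\<lambda>s. h s * k s) t)"

definition adm :: "real \<Rightarrow> (real \<Rightarrow> real) \<Rightarrow> bool" where
  "adm M k \<longleftrightarrow> continuous_on {0<..<1} k \<and> (\<forall>t\<in>{0<..<1}. 0 \<le> k t \<and> k t \<le> M)"

lemma adm_nonneg: "adm M k \<Longrightarrow> 0 \<le> M"
  unfolding adm_def by (force dest: bspec[of _ _ "1/2"])

lemma adm_mono: "adm M k \<Longrightarrow> M \<le> M' \<Longrightarrow> adm M' k"
  unfolding adm_def by force

lemma adm_cont: "adm M k \<Longrightarrow> continuous_on {0<..<1} (\<lambda>s. h s * k s)"
  unfolding adm_def by (intro continuous_on_mult h_cont) auto

lemma adm_hk: "adm M k \<Longrightarrow> t \<in> {0<..<1} \<Longrightarrow> 0 \<le> h t * k t \<and> h t * k t \<le> M * h t"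
  unfolding adm_def using h_nonneg by (auto simp: mult.commute[of M] intro: mult_left_mono)

lemma prim_hk_bound:
  assumes k: "adm M k" and t: "t \<in> {0<..<1}"
  shows "\<bar>prim (\<lambda>s. h s * k s) t\<bar> \<le> M * \<bar>prim h t\<bar>"
proof -
  note c = adm_cont[OF k]
  have c': "continuous_on {0<..<1} (\<lambda>s. M * h s)" by (intro continuous_intros h_cont)
  have hk: "0 \<le> h s * k s" "h s * k s \<le> M * h s" if "s \<in> {0<..<1}" for s
    using adm_hk[OF k that] by auto
  show ?thesis
  proof (cases "t \<le> 1/2")
    case True
    have "prim (\<lambda>s. h s * k s) (1/2) - prim (\<lambda>s. h s * k s) t
        \<le> prim (\<lambda>s. M * h s) (1/2) - prim (\<lambda>s. M * h s) t"
      by (rule prim_diff_le[OF c c']) (use True t hk in auto)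
    moreover have "prim (\<lambda>s. h s * k s) t \<le> prim (\<lambda>s. h s * k s) (1/2)"
      by (rule prim_mono[OF c]) (use True t hk in auto)
    ultimately show ?thesis
      using mult_left_mono[OF abs_ge_minus_self[of "prim h t"] adm_nonneg[OF k]]
      by (simp add: prim_cmult)
  next
    case False
    have "prim (\<lambda>s. h s * k s) t - prim (\<lambda>s. h s * k s) (1/2)
        \<le> prim (\<lambda>s. M * h s) t - prim (\<lambda>s. M * h s) (1/2)"
      by (rule prim_diff_le[OF c c']) (use False t hk in auto)
    moreover have "prim (\<lambda>s. h s * k s) (1/2) \<le> prim (\<lambda>s. h s * k s) t"
      by (rule prim_mono[OF c]) (use False t hk in auto)
    ultimately show ?thesis
      using mult_left_mono[OF abs_ge_self[of "prim h t"] adm_nonneg[OF k]]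
      by (simp add: prim_cmult)
  qed
qed

lemma a_abs_bound: "t \<in> {0<..<1} \<Longrightarrow> \<bar>a t v\<bar> \<le> L * q \<bar>v\<bar>"
  using a_bounds[of t "\<bar>v\<bar>"] a_odd[of t v] a_mono[of t 0 "\<bar>v\<bar>"] by (cases "0 \<le> v") auto

text \<open>The bound on \<open>\<bar>v\<bar>\<close> is at most \<open>2 * M\<close> when
  \<open>\<bar>prim h t\<bar> \<le> 1\<close> and at most
  \<open>2 * M * \<bar>prim h t\<bar>\<close> otherwise. In the second case \<open>q_mult_le\<close>
  splits off the integrable factor.\<close>

lemma a_abs_le_dom:
  assumes t: "t \<in> {0<..<1}" and v: "\<bar>v\<bar> \<le> M + M * \<bar>prim h t\<bar>" and M: "0 \<le> M"
  shows "\<bar>a t v\<bar> \<le> dom M t"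
proof -
  let ?H = "\<bar>prim h t\<bar>"
  have "q \<bar>v\<bar> \<le> q (2 * M) + q (2 * M) * p ?H"
  proof (cases "?H \<le> 1")
    case True
    then have "M * ?H \<le> M" using M by (simp add: mult_left_le)
    then have "q \<bar>v\<bar> \<le> q (2 * M)" using v by (intro q_mono) simp
    moreover have "0 \<le> q (2 * M) * p ?H" using M by (simp add: q_nonneg p_nonneg)
    ultimately show ?thesis by simp
  next
    case False
    then have "M * 1 \<le> M * ?H" using M by (intro mult_left_mono) auto
    then have "q \<bar>v\<bar> \<le> q (2 * M * ?H)" using v by (intro q_mono) simp
    also have "\<dots> \<le> q (2 * M) * p ?H" using M by (intro q_mult_le) auto
    finally show ?thesis using q_nonneg[of "2 * M"] M by simp
  qed
  then show ?thesis
    using a_abs_bound[OF t, of v] L_pos unfolding dom_def by (meson mult_left_mono less_imp_le order_trans)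
qed

lemma dom_integrable: "dom M integrable_on {0..1}"
proof -
  have "(\<lambda>t. L * (q (2 * M) + q (2 * M) * p \<bar>prim h t\<bar>)) integrable_on {0..1}"
    using p_prim_h_integrable
    by (intro integrable_on_mult_right integrable_add) auto
  then show ?thesis by (simp add: dom_def[abs_def])
qed

lemma ker_bound:
  assumes "adm M k" "\<bar>\<kappa>\<bar> \<le> M" "t \<in> {0<..<1}"
  shows "\<bar>ker k \<kappa> t\<bar> \<le> dom M t"
  unfolding ker_def
  by (rule a_abs_le_dom) (use prim_hk_bound[OF assms(1,3)] assms adm_nonneg[OF assms(1)] in auto)

lemma a_comp_cont:
  assumes "continuous_on {0<..<1} v"
  shows "continuous_on {0<..<1} (\<lambda>t. a t (v t))"
proof -
  have "continuous_on {0<..<1} (\<lambda>t. case (t, v t) of (t, v) \<Rightarrow> a t v)"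
    by (rule continuous_on_compose2[OF a_cont]) (use assms in \<open>auto intro!: continuous_intros\<close>)
  then show ?thesis by simp
qed

lemma a_tendsto:
  assumes t: "t \<in> {0<..<1}" and v: "(v \<longlongrightarrow> w) F"
  shows "((\<lambda>n. a t (v n)) \<longlongrightarrow> a t w) F"
proof -
  have "continuous_on UNIV (\<lambda>v. case (t, v) of (t, v) \<Rightarrow> a t v)"
    by (rule continuous_on_compose2[OF a_cont]) (use t in \<open>auto intro!: continuous_intros\<close>)
  then have "isCont (a t) w" by (simp add: continuous_on_eq_continuous_at)
  then show ?thesis using v by (rule isCont_tendsto_compose)
qed

lemma ker_cont: "adm M k \<Longrightarrow> continuous_on {0<..<1} (ker k \<kappa>)"
  unfolding ker_def by (intro a_comp_cont continuous_intros prim_continuous_on adm_cont)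

lemma integrable_dominated:
  assumes f: "continuous_on {0<..<1} f" and le: "\<And>t. t \<in> {0<..<1} \<Longrightarrow> \<bar>f t\<bar> \<le> dom M t"
  shows "f integrable_on {0..1}"
proof -
  have "f integrable_on {0<..<1}"
    by (rule measurable_bounded_by_integrable_imp_integrable_real[of _ _ "dom M"])
      (use f le dom_integrable in \<open>auto intro: continuous_imp_measurable_on_sets_lebesgue
         simp: integrable_on_open_interval_real\<close>)
  then show ?thesis by (simp add: integrable_on_open_interval_real)
qed

lemma ker_integrable:
  assumes "adm M k"
  shows "ker k \<kappa> integrable_on {0..1}"
proof (rule integrable_dominated[OF ker_cont[OF assms]])
  show "\<bar>ker k \<kappa> t\<bar> \<le> dom (max M \<bar>\<kappa>\<bar>) t" if "t \<in> {0<..<1}" for t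
    by (rule ker_bound[OF adm_mono[OF assms]]) (use that in auto)
qed

text \<open>Dominated convergence is used twice: with majorant \<open>M * h\<close> inside the
  primitive at fixed \<open>t\<close>, then with \<open>2 * dom M\<close> for the outer integral.
  Convergence in L1 is what makes the integrals up to \<open>t\<close> converge uniformly in
  \<open>t\<close>.\<close>

lemma ker_L1_tendsto:
  assumes kn: "\<And>n. adm M (K n)" and k: "adm M k"
    and lim: "\<And>t. t \<in> {0<..<1} \<Longrightarrow> (\<lambda>n. K n t) \<longlonglongrightarrow> k t"
    and lim_\<kappa>: "\<kappa>s \<longlonglongrightarrow> \<kappa>" and bd: "\<And>n. \<bar>\<kappa>s n\<bar> \<le> M"
  shows "(\<lambda>n. integral {0..1} (\<lambda>t. \<bar>ker (K n) (\<kappa>s n) t - ker k \<kappa> t\<bar>)) \<longlonglongrightarrow> 0"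
proof -
  have \<kappa>: "\<bar>\<kappa>\<bar> \<le> M"
    by (rule LIMSEQ_le_const2[OF tendsto_rabs[OF lim_\<kappa>]]) (use bd in auto)
  have "(\<lambda>n. integral {0<..<1} (\<lambda>t. \<bar>ker (K n) (\<kappa>s n) t - ker k \<kappa> t\<bar>))
      \<longlonglongrightarrow> integral {0<..<1::real} (\<lambda>t. 0)"
  proof (rule dominated_convergence(2))
    show bnd: "norm \<bar>ker (K n) (\<kappa>s n) t - ker k \<kappa> t\<bar> \<le> 2 * dom M t" if "t \<in> {0<..<1}" for n t
      using ker_bound[OF kn bd that, of n n] ker_bound[OF k \<kappa> that] by simp
    show dom2: "(\<lambda>t. 2 * dom M t) integrable_on {0<..<1}"
      using dom_integrable by (simp add: integrable_on_open_interval_real)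
    show "(\<lambda>t. \<bar>ker (K n) (\<kappa>s n) t - ker k \<kappa> t\<bar>) integrable_on {0<..<1}" for n
      by (rule measurable_bounded_by_integrable_imp_integrable[OF _ dom2 bnd])
        (auto intro!: continuous_imp_measurable_on_sets_lebesgue continuous_intros
          ker_cont[OF kn] ker_cont[OF k])
    show "(\<lambda>n. \<bar>ker (K n) (\<kappa>s n) t - ker k \<kappa> t\<bar>) \<longlonglongrightarrow> 0" if t: "t \<in> {0<..<1}" for t
    proof -
      have "(\<lambda>n. prim (\<lambda>s. h s * K n s) t) \<longlonglongrightarrow> prim (\<lambda>s. h s * k s) t"
      proof (rule prim_tendsto[OF _ adm_cont[OF kn] _ _ t])
        show "continuous_on {0<..<1} (\<lambda>s. M * h s)" by (intro continuous_intros h_cont)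
        show "\<bar>h s * K n s\<bar> \<le> M * h s" if "s \<in> {0<..<1}" for n s
          using adm_hk[OF kn[of n] that] by simp
        show "(\<lambda>n. h s * K n s) \<longlonglongrightarrow> h s * k s" if "s \<in> {0<..<1}" for s
          by (intro tendsto_mult tendsto_const lim that)
      qed
      then have "(\<lambda>n. ker (K n) (\<kappa>s n) t) \<longlonglongrightarrow> ker k \<kappa> t"
        unfolding ker_def by (intro a_tendsto t tendsto_diff lim_\<kappa>)
      then show ?thesis by (simp add: LIM_zero tendsto_rabs_zero)
    qed
  qed
  then show ?thesis by (simp add: integral_open_interval_real)
qed

section \<open>The constant of integration selected by the boundary condition at 1\<close>

definition total :: "(real \<Rightarrow> real) \<Rightarrow> real \<Rightarrow> real" where
  "total k \<kappa> = integral {0..1} (ker k \<kappa>)"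

lemma integral_diff_le_L1:
  fixes f g :: "real \<Rightarrow> real"
  assumes f: "f integrable_on {0..1}" and g: "g integrable_on {0..1}"
    and fg: "(\<lambda>t. \<bar>f t - g t\<bar>) integrable_on {0..1}" and t: "t \<in> {0..1}"
  shows "\<bar>integral {0..t} f - integral {0..t} g\<bar> \<le> integral {0..1} (\<lambda>t. \<bar>f t - g t\<bar>)"
proof -
  have sub: "u integrable_on {0..t}" if "u integrable_on {0..1}" for u :: "real \<Rightarrow> real"
    using integrable_on_subinterval[OF that] t by auto
  have "\<bar>integral {0..t} f - integral {0..t} g\<bar> = \<bar>integral {0..t} (\<lambda>t. f t - g t)\<bar>"
    using sub f g by (simp add: Henstock_Kurzweil_Integration.integral_diff)
  also have "\<dots> \<le> integral {0..t} (\<lambda>t. \<bar>f t - g t\<bar>)"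
    using integral_norm_bound_integral[of "\<lambda>t. f t - g t" "{0..t}" "\<lambda>t. \<bar>f t - g t\<bar>"]
      sub f g fg by (simp add: integrable_diff)
  also have "\<dots> \<le> integral {0..1} (\<lambda>t. \<bar>f t - g t\<bar>)"
    by (rule integral_subset_le) (use t sub fg in auto)
  finally show ?thesis .
qed

lemma ker_diff_integrable:
  assumes "adm M k" "adm M k'"
  shows "(\<lambda>t. \<bar>ker k \<kappa> t - ker k' \<kappa>' t\<bar>) integrable_on {0..1}"
proof -
  let ?M = "max M (max \<bar>\<kappa>\<bar> \<bar>\<kappa>'\<bar>)"
  have "(\<lambda>t. \<bar>ker k \<kappa> t - ker k' \<kappa>' t\<bar>) integrable_on {0<..<1}"
  proof (rule measurable_bounded_by_integrable_imp_integrable)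
    show "norm \<bar>ker k \<kappa> t - ker k' \<kappa>' t\<bar> \<le> 2 * dom ?M t" if "t \<in> {0<..<1}" for t
      using ker_bound[OF adm_mono[OF assms(1)], of ?M \<kappa> t]
        ker_bound[OF adm_mono[OF assms(2)], of ?M \<kappa>' t] that
      by (smt (verit) real_norm_def max.cobounded1 max.cobounded2)
    show "(\<lambda>t. 2 * dom ?M t) integrable_on {0<..<1}"
      using dom_integrable by (simp add: integrable_on_open_interval_real)
  qed (auto intro!: continuous_imp_measurable_on_sets_lebesgue continuous_intros
          ker_cont[OF assms(1)] ker_cont[OF assms(2)])
  then show ?thesis by (simp add: integrable_on_open_interval_real)
qed

lemma total_tendsto:
  assumes "\<And>n. adm M (K n)" "adm M k"
    "\<And>t. t \<in> {0<..<1} \<Longrightarrow> (\<lambda>n. K n t) \<longlonglongrightarrow> k t"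
    "\<kappa>s \<longlonglongrightarrow> \<kappa>" "\<And>n. \<bar>\<kappa>s n\<bar> \<le> M"
  shows "(\<lambda>n. total (K n) (\<kappa>s n)) \<longlonglongrightarrow> total k \<kappa>"
proof (rule LIM_zero_cancel)
  show "(\<lambda>n. total (K n) (\<kappa>s n) - total k \<kappa>) \<longlonglongrightarrow> 0"
  proof (rule Lim_null_comparison[OF _ ker_L1_tendsto[OF assms]])
    show "\<forall>\<^sub>F n in sequentially. norm (total (K n) (\<kappa>s n) - total k \<kappa>)
        \<le> integral {0..1} (\<lambda>t. \<bar>ker (K n) (\<kappa>s n) t - ker k \<kappa> t\<bar>)"
      unfolding total_def real_norm_def
      by (intro always_eventually allI integral_diff_le_L1 ker_integrable[OF assms(1)]
          ker_integrable[OF assms(2)] ker_diff_integrable[OF assms(1,2)]) auto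
  qed simp_all
qed

lemma total_strict_mono:
  assumes k: "adm M k" and "\<kappa> < \<kappa>'"
  shows "total k \<kappa> < total k \<kappa>'"
proof -
  have "0 < integral {0..1} (\<lambda>t. ker k \<kappa>' t - ker k \<kappa> t)"
  proof (rule integral_pos_open_unit)
    show "0 < ker k \<kappa>' t - ker k \<kappa> t" if "t \<in> {0<..<1}" for t
      using a_strict_mono[OF that] \<open>\<kappa> < \<kappa>'\<close> by (simp add: ker_def)
  qed (intro continuous_intros ker_cont[OF k] integrable_diff ker_integrable[OF k])+
  then show ?thesis
    unfolding total_def
    by (subst (asm) Henstock_Kurzweil_Integration.integral_diff)
      (auto intro: ker_integrable[OF k])
qed

text \<open>A large constant lifts the integrand to a prescribed height on the middle half, while
  elsewhere it stays above \<open>- dom M\<close>. The perturbation \<open>w\<close> is arbitrary so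
  that one \<open>K\<close> serves both signs of the primitive and all admissible right-hand
  sides.\<close>

lemma total_pos_large:
  assumes M: "0 \<le> M"
  shows "\<exists>K\<ge>M. \<forall>w. continuous_on {0<..<1} w \<and> (\<forall>t\<in>{0<..<1}. \<bar>w t\<bar> \<le> M * \<bar>prim h t\<bar>)
           \<longrightarrow> 0 < integral {0..1} (\<lambda>t. a t (K + w t))"
proof -
  have "continuous_on {1/4..3/4} (prim h)"
    by (rule continuous_on_subset[OF prim_continuous_on[OF h_cont]]) auto
  then have "bounded (prim h ` {1/4..3/4})"
    by (intro compact_imp_bounded compact_continuous_image) auto
  then obtain H0 where "\<forall>y\<in>prim h ` {1/4..3/4}. norm y \<le> H0"
    unfolding bounded_iff by blast
  then have H0: "\<bar>prim h t\<bar> \<le> H0" if "t \<in> {1/4..3/4}" for t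
    using that by (auto simp del: atLeastAtMost_iff)
  have H0_nonneg: "0 \<le> H0" using H0[of "1/2"] by simp
  define B where "B = integral {0..1} (dom M)"
  \<comment> \<open>Over the middle half, of length 1/2, the height \<open>l * q x\<close>
    contributes at least \<open>\<bar>B\<bar> + 1\<close>, which outweighs the possible loss
    \<open>B\<close>.\<close>
  obtain x0 where x0: "2 / l * (\<bar>B\<bar> + 1) \<le> q x0" using q_unbounded by blast
  define x where "x = max x0 0"
  have x: "0 \<le> x" "2 / l * (\<bar>B\<bar> + 1) \<le> q x"
    using x0 q_mono[of x0 x] by (auto simp: x_def)
  \<comment> \<open>The summand \<open>M * H0\<close> offsets \<open>w\<close> on the middle half
    and so leaves an argument of at least \<open>x\<close> there; the last summand secures
    \<open>M \<le> K\<close>.\<close>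
  define K where "K = M * H0 + x + M"
  have K: "M \<le> K" using M H0_nonneg x by (simp add: K_def)
  have "0 < integral {0..1} (\<lambda>t. a t (K + w t))"
    if w: "continuous_on {0<..<1} w" "\<forall>t\<in>{0<..<1}. \<bar>w t\<bar> \<le> M * \<bar>prim h t\<bar>" for w
  proof -
    have cont: "continuous_on {0<..<1} (\<lambda>t. a t (K + w t))"
      by (intro a_comp_cont continuous_intros w)
    have int: "(\<lambda>t. a t (K + w t)) integrable_on {0..1}"
    proof (rule integrable_dominated[OF cont])
      fix t :: real assume t: "t \<in> {0<..<1}"
      have "\<bar>w t\<bar> \<le> M * \<bar>prim h t\<bar>" using w t by blast
      also have "\<dots> \<le> K * \<bar>prim h t\<bar>" using K by (intro mult_right_mono) auto
      finally show "\<bar>a t (K + w t)\<bar> \<le> dom K t"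
        using K M by (intro a_abs_le_dom t) auto
    qed
    have ge0: "0 \<le> a t (K + w t) + dom M t" if t: "t \<in> {0<..<1}" for t
    proof -
      have wt: "\<bar>w t\<bar> \<le> M * \<bar>prim h t\<bar>" using w t by blast
      have "- dom M t \<le> a t (w t)"
        using a_abs_le_dom[OF t _ M, of "w t"] wt M by simp
      also have "\<dots> \<le> a t (K + w t)" using K M by (intro a_mono t) simp
      finally show ?thesis by simp
    qed
    have mid: "l * q x \<le> a t (K + w t) + dom M t" if t: "t \<in> {1/4..3/4}" for t
    proof -
      have t': "t \<in> {0<..<1}" using t by auto
      have "M * \<bar>prim h t\<bar> \<le> M * H0" using H0[OF t] M by (intro mult_left_mono) auto
      moreover have "\<bar>w t\<bar> \<le> M * \<bar>prim h t\<bar>" using w t' by blast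
      ultimately have "x \<le> K + w t" using M by (simp add: K_def)
      then have "a t x \<le> a t (K + w t)" by (rule a_mono[OF t'])
      moreover have "l * q x \<le> a t x" using a_bounds[OF t' x(1)] by simp
      moreover have "0 \<le> dom M t" using a_abs_le_dom[OF t', of 0 M] M by simp
      ultimately show ?thesis by simp
    qed
    have sum_int: "(\<lambda>t. a t (K + w t) + dom M t) integrable_on {0..1}"
      by (intro integrable_add int dom_integrable)
    have sub_int: "(\<lambda>t. a t (K + w t) + dom M t) integrable_on {1/4..3/4}"
      using integrable_on_subinterval[OF sum_int] by auto
    have "\<bar>B\<bar> + 1 \<le> l * q x / 2" using x(2) l_pos by (simp add: field_simps)
    also have "\<dots> = integral {1/4..3/4::real} (\<lambda>_. l * q x)"
      by (simp only: integral_const_real) simp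
    also have "\<dots> \<le> integral {1/4..3/4} (\<lambda>t. a t (K + w t) + dom M t)"
      by (rule integral_le) (use mid sub_int in auto)
    also have "\<dots> \<le> integral {0<..<1} (\<lambda>t. a t (K + w t) + dom M t)"
      by (rule integral_subset_le)
        (use ge0 sub_int sum_int in \<open>auto simp: integrable_on_open_interval_real\<close>)
    also have "\<dots> = integral {0..1} (\<lambda>t. a t (K + w t)) + B"
      unfolding B_def
      by (simp flip: integral_open_interval_real)
        (intro Henstock_Kurzweil_Integration.integral_add int dom_integrable)
    finally show ?thesis by simp
  qed
  then show ?thesis using K by blast
qed

text \<open>Oddness of \<open>a\<close> turns the claim at \<open>- K\<close> into the claim at
  \<open>K\<close> with the perturbation reflected. Since \<open>K\<close> depends on
  \<open>M\<close> alone, the bracket also bounds the zeros uniformly.\<close>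

lemma total_bracket:
  assumes M: "0 \<le> M"
  shows "\<exists>K\<ge>M. \<forall>k. adm M k \<longrightarrow> 0 < total k K \<and> total k (- K) < 0"
proof -
  obtain K where K: "K \<ge> M" and pos: "\<And>w. continuous_on {0<..<1} w \<Longrightarrow>
      (\<forall>t\<in>{0<..<1}. \<bar>w t\<bar> \<le> M * \<bar>prim h t\<bar>) \<Longrightarrow> 0 < integral {0..1} (\<lambda>t. a t (K + w t))"
    using total_pos_large[OF M] by blast
  have "0 < total k K \<and> total k (- K) < 0" if k: "adm M k" for k
  proof
    let ?w = "prim (\<lambda>s. h s * k s)"
    have w: "continuous_on {0<..<1} ?w" by (intro prim_continuous_on adm_cont[OF k])
    have b: "\<forall>t\<in>{0<..<1}. \<bar>?w t\<bar> \<le> M * \<bar>prim h t\<bar>" using prim_hk_bound[OF k] by blast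
    have "0 < integral {0..1} (\<lambda>t. a t (K + - ?w t))"
      by (rule pos) (use b in \<open>auto intro: continuous_on_minus w\<close>)
    then show "0 < total k K" by (simp add: total_def ker_def[abs_def])
    have "0 < integral {0<..<1} (\<lambda>t. a t (K + ?w t))"
      using pos[OF w b] by (simp flip: integral_open_interval_real)
    also have "\<dots> = integral {0<..<1} (\<lambda>t. - ker k (- K) t)"
    proof (rule Henstock_Kurzweil_Integration.integral_cong)
      show "a t (K + ?w t) = - ker k (- K) t" if "t \<in> {0<..<1}" for t
        using a_odd[OF that, of "K + ?w t"] by (simp add: ker_def)
    qed
    also have "\<dots> = - total k (- K)"
      by (simp add: total_def flip: integral_open_interval_real)
    finally show "total k (- K) < 0" by simp
  qed
  then show ?thesis using K by blast
qed

definition kap :: "(real \<Rightarrow> real) \<Rightarrow> real" where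
  "kap k = (THE \<kappa>. total k \<kappa> = 0)"

lemma kap_props:
  assumes k: "adm M k" and K: "K \<ge> M" "0 < total k K" "total k (- K) < 0"
  shows "total k (kap k) = 0" "\<bar>kap k\<bar> \<le> K"
proof -
  have M: "0 \<le> M" using adm_nonneg[OF k] .
  have "continuous_on {-K..K} (total k)"
    unfolding continuous_on_sequentially o_def
  proof (intro allI ballI impI)
    fix \<kappa>s :: "nat \<Rightarrow> real" and \<kappa> assume "\<kappa> \<in> {-K..K}" and s: "(\<forall>n. \<kappa>s n \<in> {-K..K}) \<and> \<kappa>s \<longlonglongrightarrow> \<kappa>"
    have "\<bar>\<kappa>s n\<bar> \<le> K" for n using s by (simp add: abs_le_iff minus_le_iff)
    then show "(\<lambda>n. total k (\<kappa>s n)) \<longlonglongrightarrow> total k \<kappa>"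
      using s total_tendsto[of K "\<lambda>_. k" k \<kappa>s \<kappa>] adm_mono[OF k K(1)] by simp
  qed
  then obtain \<kappa> where \<kappa>: "-K \<le> \<kappa>" "\<kappa> \<le> K" "total k \<kappa> = 0"
    using IVT'[of "total k" "-K" 0 K] K M by auto
  have "kap k = \<kappa>"
    unfolding kap_def
  proof (rule the_equality)
    show "\<kappa>' = \<kappa>" if "total k \<kappa>' = 0" for \<kappa>'
      using total_strict_mono[OF k, of \<kappa> \<kappa>'] total_strict_mono[OF k, of \<kappa>' \<kappa>] that \<kappa>(3)
      by (metis less_irrefl linorder_less_linear)
  qed (rule \<kappa>(3))
  then show "total k (kap k) = 0" "\<bar>kap k\<bar> \<le> K" using \<kappa> by auto
qed

lemma total_kap: "adm M k \<Longrightarrow> total k (kap k) = 0"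
  using kap_props(1) total_bracket[OF adm_nonneg] by blast

lemma kap_bound: "0 \<le> M \<Longrightarrow> \<exists>K\<ge>M. \<forall>k. adm M k \<longrightarrow> \<bar>kap k\<bar> \<le> K"
  using kap_props(2) total_bracket by meson

text \<open>No subsequences are needed: by strict monotonicity, comparing \<open>kap k\<close> with
  \<open>y\<close> amounts to reading the sign of \<open>total k y\<close>, and a strict sign
  persists under the pointwise convergence of \<open>total\<close> at \<open>y\<close>.\<close>

lemma kap_tendsto:
  assumes kn: "\<And>n. adm M (K n)" and k: "adm M k"
    and lim: "\<And>t. t \<in> {0<..<1} \<Longrightarrow> (\<lambda>n. K n t) \<longlonglongrightarrow> k t"
  shows "(\<lambda>n. kap (K n)) \<longlonglongrightarrow> kap k"
proof (rule order_tendstoI)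
  have conv: "(\<lambda>n. total (K n) y) \<longlonglongrightarrow> total k y" for y
    by (rule total_tendsto[of "max M \<bar>y\<bar>"])
      (use lim adm_mono[OF kn] adm_mono[OF k] in auto)
  have mono: "kap k' < y" if "adm M k'" "0 < total k' y" for k' y
    using total_strict_mono[OF that(1), of y "kap k'"] total_kap[OF that(1)] that(2)
    by (cases y "kap k'" rule: linorder_cases) auto
  have mono': "y < kap k'" if "adm M k'" "total k' y < 0" for k' y
    using total_strict_mono[OF that(1), of "kap k'" y] total_kap[OF that(1)] that(2)
    by (cases y "kap k'" rule: linorder_cases) auto
  show "\<forall>\<^sub>F n in sequentially. kap (K n) < y" if "kap k < y" for y
  proof -
    have "0 < total k y" using total_strict_mono[OF k that] total_kap[OF k] by simp
    from order_tendstoD(1)[OF conv this] show ?thesis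
      by eventually_elim (use mono kn in blast)
  qed
  show "\<forall>\<^sub>F n in sequentially. y < kap (K n)" if "y < kap k" for y
  proof -
    have "total k y < 0" using total_strict_mono[OF k that] total_kap[OF k] by simp
    from order_tendstoD(2)[OF conv this] show ?thesis
      by eventually_elim (use mono' kn in blast)
  qed
qed

section \<open>The solution operator: regularity, equicontinuity and continuity\<close>

definition sol :: "(real \<Rightarrow> real) \<Rightarrow> real \<Rightarrow> real" where
  "sol k t = integral {0..t} (ker k (kap k))"

lemma sol_0 [simp]: "sol k 0 = 0"
  by (simp add: sol_def)

lemma sol_1: "adm M k \<Longrightarrow> sol k 1 = 0"
  using total_kap by (simp add: sol_def total_def)

lemma sol_continuous_on: "adm M k \<Longrightarrow> continuous_on {0..1} (sol k)"
  unfolding sol_def by (intro indefinite_integral_continuous_1 ker_integrable)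

lemma sol_has_real_derivative:
  assumes k: "adm M k" and t: "t \<in> {0<..<1}"
  shows "(sol k has_real_derivative ker k (kap k) t) (at t)"
proof -
  have "(sol k has_vector_derivative ker k (kap k) t) (at t within {0..1} - {})"
    unfolding sol_def
  proof (rule integral_has_vector_derivative_continuous_at)
    have "isCont (ker k (kap k)) t"
      using ker_cont[OF k] t by (simp add: continuous_on_eq_continuous_at)
    then show "continuous (at t within {0..1} - {}) (ker k (kap k))"
      by (rule continuous_at_imp_continuous_at_within)
  qed (use t ker_integrable[OF k] in auto)
  then have "(sol k has_real_derivative ker k (kap k) t) (at t within {0<..<1})"
    unfolding has_real_derivative_iff_has_vector_derivative
    by (rule has_vector_derivative_within_subset) auto
  then show ?thesis using t at_within_open[of t "{0<..<1}"] by simp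
qed

text \<open>Increments of \<open>sol k\<close> are dominated by those of the primitive of
  \<open>dom K\<close>, where \<open>K\<close> bounds \<open>kap k\<close> for all admissible
  \<open>k\<close> at once. Uniform continuity of that one primitive suffices.\<close>

lemma sol_equicontinuous:
  assumes M: "0 \<le> M" and e: "0 < e"
  shows "\<exists>\<delta>>0. \<forall>k s t. adm M k \<longrightarrow> s \<in> {0..1} \<longrightarrow> t \<in> {0..1} \<longrightarrow> \<bar>s - t\<bar> < \<delta> \<longrightarrow>
           \<bar>sol k s - sol k t\<bar> < e"
proof -
  obtain K where K: "K \<ge> M" "\<And>k. adm M k \<Longrightarrow> \<bar>kap k\<bar> \<le> K" using kap_bound[OF M] by blast
  define D where "D t = integral {0..t} (dom K)" for t
  have "uniformly_continuous_on {0..1} D"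
    unfolding D_def
    by (intro compact_uniformly_continuous indefinite_integral_continuous_1 dom_integrable) auto
  then obtain \<delta> where \<delta>: "\<delta> > 0" "\<And>s t. s \<in> {0..1} \<Longrightarrow> t \<in> {0..1} \<Longrightarrow> \<bar>s - t\<bar> < \<delta> \<Longrightarrow> \<bar>D s - D t\<bar> < e"
    unfolding uniformly_continuous_on_def dist_real_def using e by meson
  have le: "\<bar>sol k t - sol k s\<bar> \<le> D t - D s"
    if k: "adm M k" and st: "0 \<le> s" "s \<le> t" "t \<le> 1" for k s t
  proof -
    have *: "u integrable_on {s..t}" "integral {0..t} u - integral {0..s} u = integral {s..t} u"
      if u: "u integrable_on {0..1}" for u :: "real \<Rightarrow> real"
    proof -
      show "u integrable_on {s..t}" using integrable_on_subinterval[OF u] st by auto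
      have "u integrable_on {0..t}" using integrable_on_subinterval[OF u] st by auto
      from Henstock_Kurzweil_Integration.integral_combine[OF st(1,2) this]
      show "integral {0..t} u - integral {0..s} u = integral {s..t} u" by simp
    qed
    note ki = ker_integrable[OF k, of "kap k"]
    have "\<bar>integral {s<..<t} (ker k (kap k))\<bar> \<le> integral {s<..<t} (dom K)"
      using integral_norm_bound_integral[of "ker k (kap k)" "{s<..<t}" "dom K"]
        ker_bound[OF adm_mono[OF k K(1)] K(2)[OF k]] *(1)[OF ki] *(1)[OF dom_integrable] st
      by (auto simp: integrable_on_open_interval_real)
    then show ?thesis
      unfolding sol_def D_def *(2)[OF ki] *(2)[OF dom_integrable]
      by (simp flip: integral_open_interval_real)
  qed
  have "\<bar>sol k s - sol k t\<bar> < e"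
    if "adm M k" "s \<in> {0..1}" "t \<in> {0..1}" "\<bar>s - t\<bar> < \<delta>" for k s t
    using le[OF that(1), of s t] le[OF that(1), of t s] \<delta>(2)[OF that(2-4)] that(2,3)
    by (cases "s \<le> t") (auto simp: abs_minus_commute)
  then show ?thesis using \<delta>(1) by blast
qed

text \<open>The constants \<open>kap (K n)\<close> converge, hence the derivatives converge in L1,
  and the L1 distance bounds the difference of the primitives at every \<open>t\<close>.\<close>

lemma sol_uniform_limit:
  assumes kn: "\<And>n. adm M (K n)" and k: "adm M k"
    and lim: "\<And>t. t \<in> {0<..<1} \<Longrightarrow> (\<lambda>n. K n t) \<longlonglongrightarrow> k t"
  shows "uniform_limit {0..1} (\<lambda>n. sol (K n)) (sol k) sequentially"
proof (rule uniform_limitI)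
  fix e :: real assume "0 < e"
  obtain B where B: "B \<ge> M" "\<And>k. adm M k \<Longrightarrow> \<bar>kap k\<bar> \<le> B"
    using kap_bound[OF adm_nonneg[OF k]] by blast
  have "(\<lambda>n. integral {0..1} (\<lambda>t. \<bar>ker (K n) (kap (K n)) t - ker k (kap k) t\<bar>)) \<longlonglongrightarrow> 0"
    by (rule ker_L1_tendsto[of B])
      (use adm_mono[OF kn B(1)] adm_mono[OF k B(1)] lim kap_tendsto[OF kn k lim] B(2)[OF kn] in auto)
  from order_tendstoD(2)[OF this \<open>0 < e\<close>]
  show "\<forall>\<^sub>F n in sequentially. \<forall>t\<in>{0..1}. dist (sol (K n) t) (sol k t) < e"
  proof eventually_elim
    case (elim n)
    show ?case
    proof
      fix t :: real assume "t \<in> {0..1}"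
      from le_less_trans[OF integral_diff_le_L1[OF ker_integrable[OF kn] ker_integrable[OF k]
            ker_diff_integrable[OF kn k] this] elim]
      show "dist (sol (K n) t) (sol k t) < e" by (simp add: sol_def dist_real_def)
    qed
  qed
qed

subsection \<open>Shape and size of solutions\<close>

text \<open>The derivative integrates to zero, so the flux, which has the same sign, can be neither
  positive nor negative throughout; by connectedness it vanishes somewhere.\<close>

lemma sol_turning_point:
  assumes k: "adm M k"
  obtains A where "A \<in> {0<..<1}" "kap k = prim (\<lambda>s. h s * k s) A"
proof -
  let ?v = "\<lambda>t. kap k - prim (\<lambda>s. h s * k s) t"
  have v_cont: "continuous_on {0<..<1} ?v"
    by (intro continuous_intros prim_continuous_on adm_cont[OF k])
  have int0: "integral {0..1} (ker k (kap k)) = 0"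
    using total_kap[OF k] by (simp add: total_def)
  have "\<exists>t\<in>{0<..<1}. ?v t \<le> 0"
  proof (rule ccontr)
    assume "\<not> ?thesis"
    then have "0 < ker k (kap k) t" if "t \<in> {0<..<1}" for t
      using a_strict_mono[OF that, of 0 "?v t"] that by (auto simp: ker_def not_le)
    from integral_pos_open_unit[OF ker_cont[OF k] ker_integrable[OF k] this] show False
      using int0 by simp
  qed
  then obtain t1 where t1: "t1 \<in> {0<..<1}" "?v t1 \<le> 0" by blast
  have "\<exists>t\<in>{0<..<1}. 0 \<le> ?v t"
  proof (rule ccontr)
    assume "\<not> ?thesis"
    then have "0 < - ker k (kap k) t" if "t \<in> {0<..<1}" for t
      using a_strict_mono[OF that, of "?v t" 0] that by (auto simp: ker_def not_le)
    from integral_pos_open_unit[OF continuous_on_minus[OF ker_cont[OF k]]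
        integrable_neg[OF ker_integrable[OF k]] this]
    show False using int0 by simp
  qed
  then obtain t2 where t2: "t2 \<in> {0<..<1}" "0 \<le> ?v t2" by blast
  have "connected (?v ` {0<..<1})"
    by (rule connected_continuous_image[OF v_cont]) auto
  then have "0 \<in> ?v ` {0<..<1}"
    using connectedD_interval[of "?v ` {0<..<1}" "?v t1" "?v t2" 0] t1 t2 by auto
  then obtain A where "A \<in> {0<..<1}" "?v A = 0" by auto
  then show ?thesis using that by simp
qed

lemma prim_hk_mono: "adm M k \<Longrightarrow> 0 < s \<Longrightarrow> s \<le> t \<Longrightarrow> t < 1 \<Longrightarrow>
    prim (\<lambda>s. h s * k s) s \<le> prim (\<lambda>s. h s * k s) t"
  using adm_hk by (intro prim_mono adm_cont) blast+

text \<open>The flux \<open>v\<close> is nonincreasing and vanishes at \<open>A\<close>, so it is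
  nonnegative before \<open>A\<close> and nonpositive after it. Oddness of \<open>a\<close>
  transfers the bounds to the second half.\<close>

lemma ker_sign_bounds:
  assumes k: "adm M k" and A: "A \<in> {0<..<1}" "kap k = prim (\<lambda>s. h s * k s) A"
    and t: "t \<in> {0<..<1}"
  defines "v \<equiv> \<lambda>t. kap k - prim (\<lambda>s. h s * k s) t"
  shows "t \<le> A \<Longrightarrow> 0 \<le> v t \<and> l * q (v t) \<le> ker k (kap k) t \<and> ker k (kap k) t \<le> L * q (v t)"
    and "A \<le> t \<Longrightarrow> 0 \<le> - v t \<and> l * q (- v t) \<le> - ker k (kap k) t \<and> - ker k (kap k) t \<le> L * q (- v t)"
proof -
  show "0 \<le> v t \<and> l * q (v t) \<le> ker k (kap k) t \<and> ker k (kap k) t \<le> L * q (v t)" if "t \<le> A"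
  proof -
    have "0 \<le> v t" using prim_hk_mono[OF k, of t A] that A t by (simp add: v_def)
    then show ?thesis using a_bounds[OF t] by (simp add: ker_def v_def)
  qed
  show "0 \<le> - v t \<and> l * q (- v t) \<le> - ker k (kap k) t \<and> - ker k (kap k) t \<le> L * q (- v t)" if "A \<le> t"
  proof -
    have "0 \<le> - v t" using prim_hk_mono[OF k, of A t] that A t by (simp add: v_def)
    then show ?thesis using a_bounds[OF t, of "- v t"] a_odd[OF t, of "v t"] by (simp add: ker_def v_def)
  qed
qed

text \<open>On each side of \<open>A\<close> the slope is comparable to \<open>q\<close> of the
  flux, which is monotone, so \<open>concave_like_lower_bound\<close> applies from the nearer
  endpoint up to the maximum at \<open>A\<close>.\<close>

lemma sol_shape_at:
  assumes k: "adm M k" and A: "A \<in> {0<..<1}" "kap k = prim (\<lambda>s. h s * k s) A" and t: "t \<in> {0..1}"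
  shows "l / L * min t (1 - t) * sol k A \<le> sol k t" "0 \<le> sol k t" "sol k t \<le> sol k A"
proof -
  let ?v = "\<lambda>t. kap k - prim (\<lambda>s. h s * k s) t"
  have "l / L * min t (1 - t) * sol k A \<le> sol k t \<and> 0 \<le> sol k t \<and> sol k t \<le> sol k A"
  proof (cases "t \<le> A")
    case True
    have "continuous_on {0..A} (sol k)"
      by (rule continuous_on_subset[OF sol_continuous_on[OF k]]) (use A in auto)
    note half = concave_like_lower_bound[of A "sol k" "ker k (kap k)" l "\<lambda>t. q (?v t)" L t, OF _ _ this]
    have "l / L * t * sol k A \<le> sol k t \<and> 0 \<le> sol k t \<and> sol k t \<le> sol k A"
      by (rule half)
        (use A True t l_pos l_le_L sol_has_real_derivative[OF k] ker_sign_bounds[OF k A]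
            prim_hk_mono[OF k] in \<open>auto intro: q_mono q_nonneg\<close>)
    moreover from this have "0 \<le> sol k A" by linarith
    then have "l / L * min t (1 - t) * sol k A \<le> l / L * t * sol k A"
      using l_pos L_pos by (intro mult_right_mono mult_left_mono) auto
    ultimately show ?thesis by linarith
  next
    case False
    \<comment> \<open>Reflection turns the decreasing half into an increasing one that starts from
      the boundary value 0.\<close>
    define y where "y s = sol k (1 - s)" for s
    have "continuous_on {0..1 - A} y"
      unfolding y_def
      by (rule continuous_on_compose2[OF sol_continuous_on[OF k]])
        (use A in \<open>auto intro!: continuous_intros\<close>)
    note half = concave_like_lower_bound[of "1 - A" y "\<lambda>s. - ker k (kap k) (1 - s)" l
        "\<lambda>s. q (- ?v (1 - s))" L "1 - t", OF _ _ this]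
    have deriv: "(y has_real_derivative - ker k (kap k) (1 - s)) (at s)" if "0 < s" "s < 1 - A" for s
    proof -
      have "(sol k has_real_derivative ker k (kap k) (1 - s)) (at (1 - s))"
        by (rule sol_has_real_derivative[OF k]) (use that A in auto)
      then have "((\<lambda>s. sol k (1 - s)) has_real_derivative ker k (kap k) (1 - s) * (- 1)) (at s)"
        by (rule DERIV_chain2) (auto intro!: derivative_eq_intros)
      then show ?thesis by (simp add: y_def[abs_def])
    qed
    have "l / L * (1 - t) * y (1 - A) \<le> y (1 - t) \<and> 0 \<le> y (1 - t) \<and> y (1 - t) \<le> y (1 - A)"
    proof (rule half)
      show "y 0 = 0" using sol_1[OF k] by (simp add: y_def)
      show "l * q (- ?v (1 - s)) \<le> - ker k (kap k) (1 - s) \<and>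
          - ker k (kap k) (1 - s) \<le> L * q (- ?v (1 - s)) \<and> 0 \<le> q (- ?v (1 - s))"
        if "0 < s" "s < 1 - A" for s
      proof -
        have "1 - s \<in> {0<..<1}" "A \<le> 1 - s" using that A by auto
        from ker_sign_bounds(2)[OF k A this] show ?thesis using q_nonneg[of "- ?v (1 - s)"] by blast
      qed
      show "q (- ?v (1 - u)) \<le> q (- ?v (1 - s))" if "0 < s" "s \<le> u" "u < 1 - A" for s u
        using prim_hk_mono[OF k, of "1 - u" "1 - s"] that A by (intro q_mono) auto
    qed (use A False t l_pos l_le_L deriv in auto)
    then have *: "l / L * (1 - t) * sol k A \<le> sol k t \<and> 0 \<le> sol k t \<and> sol k t \<le> sol k A"
      by (simp add: y_def)
    moreover from this have "0 \<le> sol k A" by linarith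
    then have "l / L * min t (1 - t) * sol k A \<le> l / L * (1 - t) * sol k A"
      using l_pos L_pos by (intro mult_right_mono mult_left_mono) auto
    ultimately show ?thesis by linarith
  qed
  then show "l / L * min t (1 - t) * sol k A \<le> sol k t" "0 \<le> sol k t" "sol k t \<le> sol k A"
    by blast+
qed

lemma supnorm_sol:
  assumes k: "adm M k" and A: "A \<in> {0<..<1}" "kap k = prim (\<lambda>s. h s * k s) A"
  shows "supnorm (sol k) = sol k A"
  unfolding supnorm_def
proof (rule cSup_eq_maximum)
  show "sol k A \<in> (\<lambda>t. \<bar>sol k t\<bar>) ` {0..1}"
    using sol_shape_at(2)[OF k A, of A] A by (intro image_eqI[of _ _ A]) auto
  show "x \<le> sol k A" if "x \<in> (\<lambda>t. \<bar>sol k t\<bar>) ` {0..1}" for x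
    using that sol_shape_at(2,3)[OF k A] by auto
qed

lemma sol_shape:
  assumes k: "adm M k" and t: "t \<in> {0..1}"
  shows "l / L * min t (1 - t) * supnorm (sol k) \<le> sol k t" "0 \<le> sol k t" "sol k t \<le> supnorm (sol k)"
proof -
  obtain A where A: "A \<in> {0<..<1}" "kap k = prim (\<lambda>s. h s * k s) A"
    using sol_turning_point[OF k] .
  show "l / L * min t (1 - t) * supnorm (sol k) \<le> sol k t" "0 \<le> sol k t" "sol k t \<le> supnorm (sol k)"
    using sol_shape_at[OF k A t] by (simp_all add: supnorm_sol[OF k A])
qed

text \<open>The maximum is computed from the endpoint on the same side of 1/2 as \<open>A\<close>.
  There the flux is at most \<open>M * \<bar>prim h t\<bar>\<close> in modulus, because the
  primitive at \<open>A\<close> and at 1/2 compare favourably, and \<open>q_mult_le\<close> extracts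
  the factor \<open>q M\<close>.\<close>

lemma supnorm_sol_upper:
  assumes k: "adm M k"
  shows "supnorm (sol k) \<le> L * integral {0..1} (\<lambda>s. p \<bar>prim h s\<bar>) * q M"
proof -
  obtain A where A: "A \<in> {0<..<1}" "kap k = prim (\<lambda>s. h s * k s) A"
    using sol_turning_point[OF k] .
  have M: "0 \<le> M" using adm_nonneg[OF k] .
  let ?P = "\<lambda>s. L * q M * p \<bar>prim h s\<bar>"
  let ?g = "\<lambda>s. h s * k s"
  have P_nonneg: "0 \<le> ?P s" for s
    using L_pos M by (simp add: q_nonneg p_nonneg)
  have P_int: "?P integrable_on {0..1}"
    using integrable_on_mult_right[OF p_prim_h_integrable, of "L * q M"] by simp
  have P_sub: "integral {a..b} ?P \<le> integral {0..1} ?P" if "{a..b} \<subseteq> {0..1}" for a b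
    using that P_nonneg integrable_on_subinterval[OF P_int that] P_int by (intro integral_subset_le) auto
  have key: "L * q v \<le> ?P t" if "v \<le> M * \<bar>prim h t\<bar>" for v t
  proof -
    have "q v \<le> q (M * \<bar>prim h t\<bar>)" using that by (rule q_mono)
    also have "\<dots> \<le> q M * p \<bar>prim h t\<bar>" using M by (intro q_mult_le) auto
    finally show ?thesis using L_pos by (simp add: mult.assoc)
  qed
  note ki = ker_integrable[OF k, of "kap k"]
  have "sol k A \<le> integral {0..1} ?P"
  proof (cases "A \<le> 1/2")
    case True
    have sub: "{0..A} \<subseteq> {0..1}" using A by auto
    have "integral {0<..<A} (ker k (kap k)) \<le> integral {0<..<A} ?P"
    proof (rule integral_le)
      show "ker k (kap k) t \<le> ?P t" if "t \<in> {0<..<A}" for t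
      proof -
        have t: "t \<in> {0<..<1}" "t \<le> A" using that A by auto
        have "prim ?g A \<le> prim ?g (1/2)" using prim_hk_mono[OF k, of A "1/2"] A True by simp
        then have "kap k - prim ?g t \<le> M * \<bar>prim h t\<bar>"
          using prim_hk_bound[OF k t(1)] A by simp
        then show ?thesis using key ker_sign_bounds(1)[OF k A t] by (meson order_trans)
      qed
    qed (use integrable_on_subinterval[OF ki sub] integrable_on_subinterval[OF P_int sub]
          in \<open>simp_all add: integrable_on_open_interval_real\<close>)
    then show ?thesis
      using P_sub[OF sub] by (simp add: sol_def flip: integral_open_interval_real)
  next
    case False
    have sub: "{A..1} \<subseteq> {0..1}" using A by auto
    have "integral {A<..<1} (\<lambda>t. - ker k (kap k) t) \<le> integral {A<..<1} ?P"
    proof (rule integral_le)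
      show "- ker k (kap k) t \<le> ?P t" if "t \<in> {A<..<1}" for t
      proof -
        have t: "t \<in> {0<..<1}" "A \<le> t" using that A by auto
        have "prim ?g (1/2) \<le> prim ?g A" using prim_hk_mono[OF k, of "1/2" A] A False by simp
        then have "- (kap k - prim ?g t) \<le> M * \<bar>prim h t\<bar>"
          using prim_hk_bound[OF k t(1)] A by simp
        then show ?thesis using key ker_sign_bounds(2)[OF k A t] by (meson order_trans)
      qed
    qed (use integrable_neg[OF integrable_on_subinterval[OF ki sub]] integrable_on_subinterval[OF P_int sub]
          in \<open>simp_all add: integrable_on_open_interval_real\<close>)
    \<comment> \<open>As the whole integral vanishes, the value at \<open>A\<close> equals minus the
      integral from \<open>A\<close> to 1.\<close>
    moreover have "integral {0..A} (ker k (kap k)) + integral {A..1} (ker k (kap k)) = 0"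
      using Henstock_Kurzweil_Integration.integral_combine[OF _ _ ki, of A] A total_kap[OF k]
      by (simp add: total_def)
    ultimately show ?thesis
      using P_sub[OF sub] by (simp add: sol_def flip: integral_open_interval_real)
  qed
  then show ?thesis by (simp add: supnorm_sol[OF k A] mult.commute mult.left_commute)
qed

text \<open>The interval is cut into quarters. If \<open>A\<close> lies at or beyond the midpoint,
  the flux on the first quarter is at least the growth of the primitive over the second one, which
  gives a slope bound along a full quarter. Otherwise the last and the third quarter play these
  roles.\<close>

lemma supnorm_sol_lower:
  assumes k: "adm M k" and ab: "0 < a0" "a0 < b0" "b0 < 1"
    and h0: "\<And>t. t \<in> {a0..b0} \<Longrightarrow> \<eta> \<le> h t * k t" and \<eta>: "0 \<le> \<eta>"
  shows "(b0 - a0) / 4 * (l * q ((b0 - a0) / 4 * \<eta>)) \<le> supnorm (sol k)"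
proof -
  obtain A where A: "A \<in> {0<..<1}" "kap k = prim (\<lambda>s. h s * k s) A"
    using sol_turning_point[OF k] .
  let ?g = "\<lambda>s. h s * k s"
  let ?d = "(b0 - a0) / 4"
  define e where "e = (a0 + b0) / 2"
  have d: "0 < ?d" using ab by simp
  have d5: "a0 + ?d \<le> b0" "a0 \<le> b0 - ?d" "a0 \<le> a0" using ab by (simp_all add: field_simps)
  have grow: "?d * \<eta> \<le> prim ?g (s + ?d) - prim ?g s" if "a0 \<le> s" "s + ?d \<le> b0" for s
  proof -
    have "\<exists>z. s < z \<and> z < s + ?d \<and> prim ?g (s + ?d) - prim ?g s = (s + ?d - s) * ?g z"
      by (rule MVT2) (use d that ab in \<open>auto intro!: prim_has_real_derivative adm_cont[OF k]\<close>)
    then obtain z where z: "s < z" "z < s + ?d" "prim ?g (s + ?d) - prim ?g s = ?d * ?g z" by auto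
    have "\<eta> \<le> ?g z" using h0[of z] z that by auto
    then show ?thesis unfolding z(3) using d by (intro mult_left_mono) auto
  qed
  have mvt: "\<exists>z. s < z \<and> z < s + ?d \<and> sol k (s + ?d) - sol k s = ?d * ker k (kap k) z"
    if "a0 \<le> s" "s + ?d \<le> b0" for s
  proof -
    have "\<exists>z. s < z \<and> z < s + ?d \<and> sol k (s + ?d) - sol k s = (s + ?d - s) * ker k (kap k) z"
      by (rule MVT2) (use d that ab in \<open>auto intro!: sol_has_real_derivative k\<close>)
    then show ?thesis by auto
  qed
  have "?d * (l * q (?d * \<eta>)) \<le> sol k A"
  proof (cases "e \<le> A")
    case True
    obtain z where z: "a0 < z" "z < a0 + ?d" "sol k (a0 + ?d) - sol k a0 = ?d * ker k (kap k) z"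
      using mvt[of a0] d5 by blast
    have zA: "z \<in> {0<..<1}" "z \<le> A" using z True ab A by (auto simp: e_def field_simps)
    have "?d * \<eta> \<le> prim ?g (a0 + ?d + ?d) - prim ?g (a0 + ?d)"
      using grow[of "a0 + ?d"] ab by (simp add: field_simps)
    also have "a0 + ?d + ?d = e" by (simp add: e_def field_simps)
    finally have "?d * \<eta> \<le> prim ?g e - prim ?g (a0 + ?d)" .
    moreover have "prim ?g e \<le> prim ?g A" using prim_hk_mono[OF k _ True] ab A by (auto simp: e_def)
    moreover have "prim ?g z \<le> prim ?g (a0 + ?d)" using prim_hk_mono[OF k, of z "a0 + ?d"] z ab d5 by linarith
    ultimately have "?d * \<eta> \<le> kap k - prim ?g z" using A by linarith
    then have "l * q (?d * \<eta>) \<le> ker k (kap k) z"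
      using ker_sign_bounds(1)[OF k A zA] q_mono l_pos by (meson mult_left_mono less_imp_le order_trans)
    then have "?d * (l * q (?d * \<eta>)) \<le> ?d * ker k (kap k) z" using d by (intro mult_left_mono) auto
    also have "\<dots> \<le> sol k (a0 + ?d)"
      using z(3) sol_shape_at(2)[OF k A, of a0] ab by simp
    also have "\<dots> \<le> sol k A" using ab d d5 by (intro sol_shape_at(3)[OF k A]) (unfold atLeastAtMost_iff, linarith)
    finally show ?thesis .
  next
    case False
    have b': "b0 - ?d = e + ?d" by (simp add: e_def field_simps)
    obtain z where z: "b0 - ?d < z" "z < b0" "sol k b0 - sol k (b0 - ?d) = ?d * ker k (kap k) z"
      using mvt[of "b0 - ?d"] d5 by auto
    have "0 < e" using ab by (simp add: e_def)
    then have zA: "z \<in> {0<..<1}" "A \<le> z"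
      using z(1,2) False ab d unfolding b' greaterThanLessThan_iff by linarith+
    have "?d * \<eta> \<le> prim ?g (e + ?d) - prim ?g e"
      using grow[of e] ab by (simp add: e_def field_simps)
    also have "prim ?g A \<le> prim ?g e" using prim_hk_mono[OF k, of A e] ab A False by (auto simp: e_def)
    then have "prim ?g (e + ?d) - prim ?g e \<le> prim ?g (e + ?d) - prim ?g A" by simp
    also have "prim ?g (e + ?d) \<le> prim ?g z"
      by (rule prim_hk_mono[OF k]) (use z(1,2) d ab \<open>0 < e\<close> in \<open>unfold b', linarith+\<close>)
    then have "prim ?g (e + ?d) - prim ?g A \<le> - (kap k - prim ?g z)" using A by simp
    finally have "?d * \<eta> \<le> - (kap k - prim ?g z)" .
    then have "l * q (?d * \<eta>) \<le> - ker k (kap k) z"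
      using ker_sign_bounds(2)[OF k A zA] q_mono l_pos by (meson mult_left_mono less_imp_le order_trans)
    then have "?d * (l * q (?d * \<eta>)) \<le> ?d * (- ker k (kap k) z)" using d by (intro mult_left_mono) auto
    also have "\<dots> \<le> sol k (b0 - ?d)"
      using z(3) sol_shape_at(2)[OF k A, of b0] ab by simp
    also have "\<dots> \<le> sol k A" using ab d d5 by (intro sol_shape_at(3)[OF k A]) (unfold atLeastAtMost_iff, linarith)
    finally show ?thesis .
  qed
  then show ?thesis by (simp add: supnorm_sol[OF k A])
qed

end

subsection \<open>Fixed points of prescribed size\<close>

lemma abs_le_supnorm:
  assumes "continuous_on {0..1} u" "t \<in> {0..1}"
  shows "\<bar>u t\<bar> \<le> supnorm u"
  unfolding supnorm_def
proof (rule cSUP_upper[OF assms(2)])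
  have "compact ((\<lambda>t. \<bar>u t\<bar>) ` {0..1})"
    by (intro compact_continuous_image continuous_intros assms(1)) auto
  then show "bdd_above ((\<lambda>t. \<bar>u t\<bar>) ` {0..1})" by (intro bounded_imp_bdd_above compact_imp_bounded)
qed

lemma supnorm_le: "(\<And>t. t \<in> {0..1} \<Longrightarrow> \<bar>u t\<bar> \<le> B) \<Longrightarrow> supnorm u \<le> B"
  unfolding supnorm_def by (rule cSUP_least) auto

lemma supnorm_tendsto:
  assumes U: "\<And>n. continuous_on {0..1} (U n)" and u: "continuous_on {0..1} u"
    and lim: "uniform_limit {0..1} U u sequentially"
  shows "(\<lambda>n. supnorm (U n)) \<longlonglongrightarrow> supnorm u"
proof (rule tendstoI)
  fix e :: real assume "0 < e"
  then have "\<forall>\<^sub>F n in sequentially. \<forall>t\<in>{0..1}. dist (U n t) (u t) < e / 2"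
    using lim by (intro uniform_limitD) auto
  then show "\<forall>\<^sub>F n in sequentially. dist (supnorm (U n)) (supnorm u) < e"
  proof eventually_elim
    case (elim n)
    have "supnorm (U n) \<le> supnorm u + e / 2"
    proof (rule supnorm_le)
      fix t :: real assume t: "t \<in> {0..1}"
      show "\<bar>U n t\<bar> \<le> supnorm u + e / 2"
        using abs_le_supnorm[OF u t] elim[rule_format, OF t] unfolding dist_real_def by linarith
    qed
    moreover have "supnorm u \<le> supnorm (U n) + e / 2"
    proof (rule supnorm_le)
      fix t :: real assume t: "t \<in> {0..1}"
      show "\<bar>u t\<bar> \<le> supnorm (U n) + e / 2"
        using abs_le_supnorm[OF U t, of n] elim[rule_format, OF t] unfolding dist_real_def by linarith
    qed
    ultimately show ?case using \<open>0 < e\<close> by (simp add: dist_real_def abs_le_iff abs_less_iff)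
  qed
qed

locale bvp_problem = bvp_operator +
  fixes f :: "real \<Rightarrow> real"
  assumes f_cont: "continuous_on {0..} f"
    and f_nonneg: "0 \<le> s \<Longrightarrow> 0 \<le> f s"
    and f_pos: "0 < s \<Longrightarrow> 0 < f s"
    and h_nonzero: "\<exists>t\<in>{0<..<1}. h t \<noteq> 0"
begin

text \<open>The lower profile of \<open>sol_shape\<close> for solutions normalised to sup norm
  1.\<close>

definition tent :: "real \<Rightarrow> real" where "tent t = l / L * min t (1 - t)"

definition box :: "(real \<Rightarrow> real) \<Rightarrow> bool" where
  "box w \<longleftrightarrow> continuous_on {0..1} w \<and> (\<forall>t\<in>{0..1}. tent t \<le> w t \<and> w t \<le> 1)"

text \<open>The problem in integral form: a positive \<open>u\<close> is the image under
  \<open>sol\<close> of its own right-hand side.\<close>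

definition solves :: "real \<Rightarrow> (real \<Rightarrow> real) \<Rightarrow> bool" where
  "solves lam u \<longleftrightarrow> (\<exists>M k. adm M k \<and> u = sol k \<and> (\<forall>t\<in>{0..1}. k t = lam * f (u t))) \<and>
     (\<forall>t\<in>{0<..<1}. 0 < u t)"

lemma tent_bounds: "t \<in> {0..1} \<Longrightarrow> 0 \<le> tent t \<and> tent t \<le> 1"
proof -
  assume t: "t \<in> {0..1}"
  have "l / L * min t (1 - t) \<le> 1 * 1"
    using l_pos l_le_L t by (intro mult_mono) auto
  then show ?thesis using l_pos L_pos t by (simp add: tent_def)
qed

lemma tent_pos: "t \<in> {0<..<1} \<Longrightarrow> 0 < tent t"
  using l_pos L_pos by (simp add: tent_def)

lemma tent_cont: "continuous_on S tent"
  unfolding tent_def by (intro continuous_intros)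

lemma box_bounds: "box w \<Longrightarrow> t \<in> {0..1} \<Longrightarrow> 0 \<le> w t \<and> w t \<le> 1"
  unfolding box_def using tent_bounds by (meson order_trans)

lemma adm_nonlinearity:
  assumes w: "box w" and m: "0 \<le> m" "m \<le> R" and B: "\<And>s. s \<in> {0..R} \<Longrightarrow> f s \<le> B" and lam: "0 \<le> lam"
  shows "adm (lam * B) (\<lambda>t. lam * f (m * w t))"
proof -
  have mw: "m * w t \<in> {0..R}" if "t \<in> {0..1}" for t
    using box_bounds[OF w that] m mult_mono[of m R "w t" 1] by auto
  have "continuous_on {0..1} (\<lambda>t. lam * f (m * w t))"
    by (intro continuous_on_mult continuous_on_const continuous_on_compose2[OF f_cont])
      (use w mw in \<open>auto simp: box_def intro!: continuous_intros\<close>)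
  then have "continuous_on {0<..<1} (\<lambda>t. lam * f (m * w t))"
    by (rule continuous_on_subset) auto
  then show ?thesis
    unfolding adm_def using mw f_nonneg B lam by (auto intro!: mult_left_mono)
qed

lemma f_bounded: "\<exists>B. \<forall>s\<in>{0..R}. f s \<le> B"
proof -
  have "compact (f ` {0..R})"
    by (intro compact_continuous_image continuous_on_subset[OF f_cont]) auto
  then have "bounded (f ` {0..R})" by (rule compact_imp_bounded)
  then show ?thesis unfolding bounded_iff by (auto simp: abs_le_iff)
qed

lemma h_pos_interval:
  obtains a0 b0 h0 where "0 < a0" "a0 < b0" "b0 < 1" "0 < h0" "\<And>t. t \<in> {a0..b0} \<Longrightarrow> h0 \<le> h t"
proof -
  obtain t0 where t0: "t0 \<in> {0<..<1}" "0 < h t0"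
    using h_nonzero h_nonneg by (metis order_le_less)
  have "isCont h t0" using h_cont t0 by (simp add: continuous_on_eq_continuous_at)
  then have "\<forall>\<^sub>F t in nhds t0. h t0 / 2 < h t"
    using t0 by (intro order_tendstoD) (auto simp: isCont_def tendsto_at_iff_tendsto_nhds)
  then obtain e where e: "0 < e" "\<And>t. dist t t0 < e \<Longrightarrow> h t0 / 2 < h t"
    unfolding eventually_nhds_metric by blast
  define b0 where "b0 = min (t0 + e / 2) ((t0 + 1) / 2)"
  have "t0 < b0" "b0 < 1" "b0 \<le> t0 + e / 2" using t0 e(1) by (auto simp: b0_def min_less_iff_disj)
  moreover have "h t0 / 2 \<le> h t" if "t \<in> {t0..b0}" for t
    using that e(1) \<open>b0 \<le> t0 + e / 2\<close> by (intro less_imp_le e(2)) (auto simp: dist_real_def)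
  ultimately show ?thesis using t0 by (intro that[of t0 b0 "h t0 / 2"]) auto
qed

text \<open>On an interval where \<open>h\<close> is bounded below, \<open>tent\<close> keeps
  \<open>m * w t\<close> inside a compact subset of the positive axis, and there \<open>f\<close>
  has a positive minimum. The constants therefore do not depend on \<open>lam\<close>,
  \<open>m\<close> or \<open>w\<close>.\<close>

lemma supnorm_sol_lower_box:
  assumes r: "0 < r"
  obtains D E where "0 < D" "0 < E"
    "\<And>lam m w. 0 < lam \<Longrightarrow> r \<le> m \<Longrightarrow> m \<le> R \<Longrightarrow> box w \<Longrightarrow>
      D * q (E * lam) \<le> supnorm (sol (\<lambda>t. lam * f (m * w t)))"
proof (cases "r \<le> R")
  case False
  \<comment> \<open>No amplitude \<open>m\<close> exists in this case, so any positive constants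
    do.\<close>
  then show ?thesis by (intro that[of 1 1]) auto
next
  case True
  obtain a0 b0 h0 where ab: "0 < a0" "a0 < b0" "b0 < 1" and h0: "0 < h0" "\<And>t. t \<in> {a0..b0} \<Longrightarrow> h0 \<le> h t"
    by (rule h_pos_interval) blast
  define \<delta> where "\<delta> = min (tent a0) (tent b0)"
  have \<delta>: "0 < \<delta>" "\<delta> \<le> 1" using tent_pos[of a0] tent_pos[of b0] tent_bounds[of a0] ab by (auto simp: \<delta>_def)
  have \<delta>_le: "\<delta> \<le> tent t" if "t \<in> {a0..b0}" for t
  proof -
    \<comment> \<open>By concavity of \<open>tent\<close> its minimum over the interval is attained
      at an endpoint.\<close>
    have "min (min a0 (1 - a0)) (min b0 (1 - b0)) \<le> min t (1 - t)" using that by auto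
    then have "l / L * min (min a0 (1 - a0)) (min b0 (1 - b0)) \<le> tent t"
      unfolding tent_def using l_pos L_pos by (intro mult_left_mono) auto
    then show ?thesis
      using l_pos L_pos by (simp add: \<delta>_def tent_def min_mult_distrib_left)
  qed
  have sub: "{r * \<delta>..R} \<subseteq> {0..}" using r \<delta> by auto
  have "r * \<delta> \<le> R" using True r \<delta> mult_mono[of r R \<delta> 1] by auto
  then obtain s0 where s0: "s0 \<in> {r * \<delta>..R}" "\<And>s. s \<in> {r * \<delta>..R} \<Longrightarrow> f s0 \<le> f s"
    using continuous_attains_inf[OF compact_Icc _ continuous_on_subset[OF f_cont sub]] by auto
  have "0 < r * \<delta>" using r \<delta> by simp
  then have fs0: "0 < f s0" using s0(1) by (intro f_pos) auto
  let ?d = "(b0 - a0) / 4"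
  show ?thesis
  proof (rule that[of "?d * l" "?d * (h0 * f s0)"])
    show "0 < ?d * l" "0 < ?d * (h0 * f s0)" using ab l_pos h0(1) fs0 by auto
    fix lam m :: real and w assume lam: "0 < lam" and m: "r \<le> m" "m \<le> R" and w: "box w"
    obtain B where B: "\<forall>s\<in>{0..R}. f s \<le> B" using f_bounded by blast
    have k: "adm (lam * B) (\<lambda>t. lam * f (m * w t))"
      by (rule adm_nonlinearity[OF w, of _ R]) (use m r B lam in auto)
    have "?d * (l * q (?d * (h0 * (lam * f s0)))) \<le> supnorm (sol (\<lambda>t. lam * f (m * w t)))"
    proof (rule supnorm_sol_lower[OF k ab])
      fix t assume t: "t \<in> {a0..b0}"
      have t': "t \<in> {0..1}" using t ab by auto
      have "\<delta> \<le> w t" using \<delta>_le[OF t] w t' unfolding box_def by (meson order_trans)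
      then have "r * \<delta> \<le> m * w t" using m r \<delta> by (intro mult_mono) auto
      moreover have "m * w t \<le> R * 1" using m r box_bounds[OF w t'] by (intro mult_mono) auto
      ultimately have "f s0 \<le> f (m * w t)" by (intro s0(2)) auto
      then show "h0 * (lam * f s0) \<le> h t * (lam * f (m * w t))"
        using h0 t lam fs0 by (intro mult_mono) (auto intro: less_imp_le order_trans)
    qed (use h0 lam fs0 in auto)
    then show "?d * l * q (?d * (h0 * f s0) * lam) \<le> supnorm (sol (\<lambda>t. lam * f (m * w t)))"
      by (simp add: mult_ac)
  qed
qed

text \<open>The factor \<open>\<sigma>\<close> orients the drift of the amplitude so that it points
  into the interval at both \<open>r\<close> and \<open>R\<close>. A clamped fixed point with
  nonzero drift would have to sit at an end towards which it is pushed, which the hypotheses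
  exclude.\<close>

lemma solution_between:
  assumes lam: "0 < lam" and rR: "0 < r" "r < R" and \<sigma>: "\<sigma> = 1 \<or> \<sigma> = -1"
    and at_r: "\<And>w. box w \<Longrightarrow> 0 < \<sigma> * (supnorm (sol (\<lambda>t. lam * f (r * w t))) - r)"
    and at_R: "\<And>w. box w \<Longrightarrow> \<sigma> * (supnorm (sol (\<lambda>t. lam * f (R * w t))) - R) < 0"
  shows "\<exists>u. solves lam u \<and> r < supnorm u \<and> supnorm u < R"
proof -
  \<comment> \<open>The isolated point 2 carries the amplitude \<open>m\<close>, so that the pair \<open>(m, w)\<close> becomes a single function.\<close>
  define S :: "real set" where "S = {0..1} \<union> {2}"
  define m where "m u = r + (R - r) * u 2" for u :: "real \<Rightarrow> real"
  \<comment> \<open>Truncation from below by \<open>tent\<close> places every argument in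
    \<open>box\<close>, although unit-valued functions need not lie there. At the fixed point the
    truncation turns out to be inactive.\<close>
  define w where "w u t = max (tent t) (u t)" for u t
  define k where "k u = (\<lambda>t. lam * f (m u * w u t))" for u
  define N where "N u = supnorm (sol (k u))" for u
  define F where "F u t = (if t \<le> 1 then sol (k u) t / N u
      else max 0 (min 1 (u 2 + \<sigma> * (N u - m u))))" for u and t :: real
  have S: "compact S" by (simp add: S_def compact_Un)
  obtain B where B: "\<forall>s\<in>{0..R}. f s \<le> B" using f_bounded by blast
  obtain D E where DE: "0 < D" "0 < E" and lower: "\<And>lam m w. 0 < lam \<Longrightarrow> r \<le> m \<Longrightarrow> m \<le> R \<Longrightarrow> box w \<Longrightarrow>
      D * q (E * lam) \<le> supnorm (sol (\<lambda>t. lam * f (m * w t)))"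
    by (rule supnorm_sol_lower_box[OF rR(1), of R]) blast
  \<comment> \<open>A positive lower bound for all norms \<open>N u\<close>, so that dividing by
    \<open>N u\<close> preserves equicontinuity.\<close>
  define N0 where "N0 = D * q (E * lam)"
  have N0: "0 < N0" using DE lam by (simp add: N0_def q_pos)
  have m_bounds: "r \<le> m u \<and> m u \<le> R" if u: "u \<in> unit_functions S" for u
  proof -
    have "0 \<le> u 2" "u 2 \<le> 1" using u by (auto simp: unit_functions_def S_def)
    then have "0 \<le> (R - r) * u 2" "(R - r) * u 2 \<le> (R - r) * 1" using rR by (auto intro: mult_left_mono)
    then show ?thesis by (simp add: m_def)
  qed
  have w_box: "box (w u)" if u: "u \<in> unit_functions S" for u
  proof -
    have "continuous_on {0..1} u"
      using u by (auto simp: unit_functions_def S_def intro: continuous_on_subset)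
    then show ?thesis
      unfolding box_def w_def using u tent_bounds
      by (auto simp: unit_functions_def S_def intro!: continuous_intros tent_cont)
  qed
  have k_adm: "adm (lam * B) (k u)" if "u \<in> unit_functions S" for u
    unfolding k_def
    by (rule adm_nonlinearity[OF w_box[OF that], of _ R]) (use m_bounds[OF that] rR B lam in auto)
  have N_ge: "N0 \<le> N u" if "u \<in> unit_functions S" for u
    unfolding N_def N0_def k_def using m_bounds[OF that] by (intro lower lam w_box that) auto
  have N_pos: "0 < N u" if "u \<in> unit_functions S" for u
    using N_ge[OF that] N0 by simp
  have maps: "F u \<in> unit_functions S" if u: "u \<in> unit_functions S" for u
  proof -
    have "continuous_on {0..1} (\<lambda>t. sol (k u) t / N u)"
      using N_pos[OF u] by (intro continuous_intros sol_continuous_on[OF k_adm[OF u]]) auto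
    then have "continuous_on {0..1} (F u)"
      by (rule continuous_on_eq) (auto simp: F_def)
    then have "continuous_on S (F u)"
      unfolding S_def by (intro continuous_on_closed_Un) auto
    moreover have "F u t \<in> {0..1}" if "t \<in> S" for t
      using sol_shape(2,3)[OF k_adm[OF u], of t] N_pos[OF u] that
      by (auto simp: F_def S_def N_def)
    ultimately show ?thesis by (simp add: unit_functions_def)
  qed
  obtain u where u: "u \<in> unit_functions S" and fixed: "\<forall>t\<in>S. F u t = u t"
  proof (rule schauder_unit_functions[OF S maps])
    fix U u t
    assume U: "\<And>n. U n \<in> unit_functions S" and u: "u \<in> unit_functions S"
      and lim: "uniform_limit S U u sequentially" and t: "t \<in> S"
    have U_lim: "(\<lambda>n. U n s) \<longlonglongrightarrow> u s" if "s \<in> S" for s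
      using tendsto_uniform_limitI[OF lim that] .
    have m_lim: "(\<lambda>n. m (U n)) \<longlonglongrightarrow> m u"
      unfolding m_def by (intro tendsto_intros U_lim) (simp add: S_def)
    have k_lim: "(\<lambda>n. k (U n) s) \<longlonglongrightarrow> k u s" if s: "s \<in> {0<..<1}" for s
    proof -
      have "(\<lambda>n. w (U n) s) \<longlonglongrightarrow> w u s"
        unfolding w_def using s by (intro tendsto_intros U_lim) (simp add: S_def)
      then have "(\<lambda>n. m (U n) * w (U n) s) \<longlonglongrightarrow> m u * w u s"
        by (intro tendsto_mult m_lim)
      then have "(\<lambda>n. f (m (U n) * w (U n) s)) \<longlonglongrightarrow> f (m u * w u s)"
      proof (rule continuous_on_tendsto_compose[OF f_cont])
        have "0 \<le> m v * w v s" if "v \<in> unit_functions S" for v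
          using m_bounds[OF that] box_bounds[OF w_box[OF that], of s] s rR by (intro mult_nonneg_nonneg) auto
        then show "m u * w u s \<in> {0..}" "\<forall>\<^sub>F n in sequentially. m (U n) * w (U n) s \<in> {0..}"
          using u U by auto
      qed
      then show ?thesis unfolding k_def by (intro tendsto_mult tendsto_const)
    qed
    have sol_lim: "uniform_limit {0..1} (\<lambda>n. sol (k (U n))) (sol (k u)) sequentially"
      by (rule sol_uniform_limit[OF k_adm[OF U] k_adm[OF u] k_lim])
    have N_lim: "(\<lambda>n. N (U n)) \<longlonglongrightarrow> N u"
      unfolding N_def
      by (intro supnorm_tendsto sol_lim sol_continuous_on[OF k_adm[OF U]] sol_continuous_on[OF k_adm[OF u]])
    show "(\<lambda>n. F (U n) t) \<longlonglongrightarrow> F u t"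
    proof (cases "t \<le> 1")
      case True
      then have "(\<lambda>n. sol (k (U n)) t / N (U n)) \<longlonglongrightarrow> sol (k u) t / N u"
        using t N_pos[OF u]
        by (intro tendsto_divide N_lim tendsto_uniform_limitI[OF sol_lim]) (auto simp: S_def)
      then show ?thesis using True by (simp add: F_def)
    next
      case False
      have "(\<lambda>n. max 0 (min 1 (U n 2 + \<sigma> * (N (U n) - m (U n)))))
          \<longlonglongrightarrow> max 0 (min 1 (u 2 + \<sigma> * (N u - m u)))"
        by (intro tendsto_intros U_lim N_lim m_lim) (simp add: S_def)
      then show ?thesis using False by (simp add: F_def)
    qed
  next
    fix e :: real assume "0 < e"
    have "0 \<le> lam * B" using adm_nonneg[OF k_adm, of "\<lambda>_. 0"] by (simp add: unit_functions_def)
    from sol_equicontinuous[OF this, of "e * N0"] \<open>0 < e\<close> N0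
    obtain \<delta> where \<delta>: "0 < \<delta>" "\<And>k s t. adm (lam * B) k \<Longrightarrow> s \<in> {0..1} \<Longrightarrow> t \<in> {0..1} \<Longrightarrow>
        \<bar>s - t\<bar> < \<delta> \<Longrightarrow> \<bar>sol k s - sol k t\<bar> < e * N0"
      by auto
    \<comment> \<open>The radius is capped at 1/2 so that two distinct points this close both lie in
      \<open>{0..1}\<close>; the isolated point 2 is close only to itself.\<close>
    have "\<bar>F u s - F u t\<bar> < e"
      if u: "u \<in> unit_functions S" and st: "s \<in> S" "t \<in> S" "dist s t < min \<delta> (1/2)" for u s t
    proof (cases "s \<in> {0..1} \<and> t \<in> {0..1}")
      case True
      then have "\<bar>sol (k u) s - sol (k u) t\<bar> < e * N0"
        using st by (intro \<delta>(2)[OF k_adm[OF u]]) (auto simp: dist_real_def)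
      also have "\<dots> \<le> e * N u" using N_ge[OF u] \<open>0 < e\<close> by (intro mult_left_mono) auto
      finally have "\<bar>sol (k u) s - sol (k u) t\<bar> / N u < e" using N_pos[OF u] by (simp add: divide_less_eq)
      moreover have "F u s - F u t = (sol (k u) s - sol (k u) t) / N u"
        using True by (simp add: F_def diff_divide_distrib)
      ultimately show ?thesis using N_pos[OF u] by (simp add: abs_divide)
    next
      case False
      then have "s = t" using st by (auto simp: S_def dist_real_def)
      then show ?thesis using \<open>0 < e\<close> by simp
    qed
    then show "\<exists>\<delta>>0. \<forall>u\<in>unit_functions S. \<forall>s\<in>S. \<forall>t\<in>S. dist s t < \<delta> \<longrightarrow> \<bar>F u s - F u t\<bar> < e"
      using \<delta>(1) by (intro exI[of _ "min \<delta> (1/2)"]) auto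
  qed
  have u2: "0 \<le> u 2" "u 2 \<le> 1" using u by (auto simp: unit_functions_def S_def)
  have u2_fixed: "u 2 = max 0 (min 1 (u 2 + \<sigma> * (N u - m u)))"
    using bspec[OF fixed, of 2] by (simp add: S_def F_def)
  \<comment> \<open>A positive drift is compatible with the clamped equation only at the upper end
    \<open>u 2 = 1\<close>, that is at amplitude \<open>R\<close>, where the drift is
    negative.\<close>
  have not_pos: "\<not> 0 < \<sigma> * (N u - m u)"
  proof
    assume *: "0 < \<sigma> * (N u - m u)"
    then have "u 2 = 1" using u2 u2_fixed by linarith
    then have mR: "m u = R" by (simp add: m_def)
    show False using at_R[OF w_box[OF u]] * by (simp add: N_def k_def mR)
  qed
  have not_neg: "\<not> \<sigma> * (N u - m u) < 0"
  proof
    assume *: "\<sigma> * (N u - m u) < 0"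
    then have "u 2 = 0" using u2 u2_fixed by linarith
    then have mr: "m u = r" by (simp add: m_def)
    show False using at_r[OF w_box[OF u]] * by (simp add: N_def k_def mr)
  qed
  have Nm: "N u = m u" using not_pos not_neg \<sigma> by auto
  have "m u \<noteq> r"
  proof
    assume mr: "m u = r"
    show False using at_r[OF w_box[OF u]] Nm by (simp add: N_def k_def mr)
  qed
  moreover have "m u \<noteq> R"
  proof
    assume mR: "m u = R"
    show False using at_R[OF w_box[OF u]] Nm by (simp add: N_def k_def mR)
  qed
  ultimately have m_strict: "r < m u" "m u < R" using m_bounds[OF u] by auto
  have sol_eq: "sol (k u) t = m u * w u t" if t: "t \<in> {0..1}" for t
  proof -
    have ut: "u t = sol (k u) t / N u" using bspec[OF fixed, of t] t by (simp add: S_def F_def)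
    \<comment> \<open>The shape estimate for \<open>sol\<close> shows that the fixed point already
      dominates \<open>tent\<close>.\<close>
    have "tent t * N u \<le> sol (k u) t"
      using sol_shape(1)[OF k_adm[OF u] t] by (simp add: tent_def N_def)
    then have "tent t \<le> u t" using N_pos[OF u] by (simp add: ut pos_le_divide_eq)
    then have "w u t = u t" by (simp add: w_def)
    then show ?thesis using ut Nm N_pos[OF u] by simp
  qed
  have "solves lam (sol (k u))"
    unfolding solves_def
  proof (intro conjI exI ballI)
    show "adm (lam * B) (k u)" using k_adm[OF u] .
    show "k u t = lam * f (sol (k u) t)" if "t \<in> {0..1}" for t
      using sol_eq[OF that] by (simp add: k_def)
    show "0 < sol (k u) t" if t: "t \<in> {0<..<1}" for t
    proof -
      have "0 < w u t" using tent_pos[OF t] by (simp add: w_def less_max_iff_disj)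
      then show ?thesis using sol_eq[of t] t m_strict rR by simp
    qed
  qed simp
  then show ?thesis using m_strict Nm unfolding N_def by metis
qed

text \<open>First \<open>lam\<close> is taken so large that the image norm exceeds
  \<open>\<rho>\<close> at amplitude \<open>\<rho>\<close>. For this \<open>lam\<close> smallness of
  \<open>f\<close> relative to \<open>\<phi>\<close> gives amplitudes \<open>r < \<rho> < R\<close>
  with image norm below the amplitude. The lower interval then has orientation -1 and the upper one
  orientation 1.\<close>

lemma two_solutions:
  assumes q_inv: "\<And>x. q (\<phi> x) = x" and \<phi>_nonneg: "\<And>x. 0 \<le> x \<Longrightarrow> 0 \<le> \<phi> x"
    and p_small: "\<And>e. 0 < e \<Longrightarrow> \<exists>y>0. p y < e"
    and f_small: "\<And>e \<rho>. 0 < e \<Longrightarrow> 0 < \<rho> \<Longrightarrow> \<exists>r. 0 < r \<and> r < \<rho> \<and> (\<forall>s\<in>{0..r}. f s \<le> e * \<phi> r)"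
    and f_large: "\<And>e \<rho>. 0 < e \<Longrightarrow> 0 < \<rho> \<Longrightarrow> \<exists>R>\<rho>. \<forall>s\<in>{0..R}. f s \<le> e * \<phi> R"
    and \<rho>: "0 < \<rho>"
  shows "\<exists>\<Lambda>>0. \<forall>lam\<ge>\<Lambda>. \<exists>u v. solves lam u \<and> solves lam v \<and>
           0 < supnorm u \<and> supnorm u < \<rho> \<and> \<rho> < supnorm v"
proof -
  obtain D E where DE: "0 < D" "0 < E" and lower: "\<And>lam m w. 0 < lam \<Longrightarrow> \<rho> \<le> m \<Longrightarrow> m \<le> \<rho> \<Longrightarrow> box w \<Longrightarrow>
      D * q (E * lam) \<le> supnorm (sol (\<lambda>t. lam * f (m * w t)))"
    by (rule supnorm_sol_lower_box[OF \<rho>, of \<rho>]) blast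
  \<comment> \<open>Any \<open>lam\<close> with \<open>E * lam \<ge> x\<close> makes the lower bound
    \<open>D * q (E * lam)\<close> at least \<open>\<rho> + 1\<close>.\<close>
  obtain x where x: "(\<rho> + 1) / D \<le> q x" using q_unbounded by blast
  define \<Lambda> where "\<Lambda> = max 1 (x / E)"
  have "\<exists>u v. solves lam u \<and> solves lam v \<and> 0 < supnorm u \<and> supnorm u < \<rho> \<and> \<rho> < supnorm v"
    if lam_ge: "\<Lambda> \<le> lam" for lam
  proof -
    have lam: "0 < lam" "x / E \<le> lam" using lam_ge by (auto simp: \<Lambda>_def)
    have at_\<rho>: "\<rho> < supnorm (sol (\<lambda>t. lam * f (\<rho> * w t)))" if "box w" for w
    proof -
      have "x \<le> E * lam" using lam DE by (simp add: field_simps)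
      then have "(\<rho> + 1) / D \<le> q (E * lam)" using x q_mono by (meson order_trans)
      then have "\<rho> + 1 \<le> D * q (E * lam)" using DE by (simp add: field_simps)
      then show ?thesis using lower[OF lam(1) order_refl order_refl that] by linarith
    qed
    define I where "I = integral {0..1} (\<lambda>s. p \<bar>prim h s\<bar>)"
    have I: "0 \<le> I" unfolding I_def
      by (rule Henstock_Kurzweil_Integration.integral_nonneg[OF p_prim_h_integrable]) (simp add: p_nonneg)
    \<comment> \<open>Chosen so that \<open>L * I * p y < 1\<close>; the added 1 keeps the
      denominator positive when only \<open>0 \<le> I\<close> is known.\<close>
    obtain y where y: "0 < y" "p y < 1 / (L * I + 1)"
      using p_small[of "1 / (L * I + 1)"] L_pos I by (auto simp: add_nonneg_pos)
    have LIp: "L * I * p y < 1"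
    proof -
      have "0 < L * I + 1" using L_pos I by (simp add: add_nonneg_pos)
      then have "(L * I + 1) * p y < 1" using y(2) by (simp add: field_simps)
      then show ?thesis using p_nonneg[of y] y(1) by (simp add: algebra_simps)
    qed
    have upper: "supnorm (sol (\<lambda>t. lam * f (r * w t))) < r"
      if r: "0 < r" and fr: "\<forall>s\<in>{0..r}. f s \<le> y / lam * \<phi> r" and w: "box w" for r w
    proof -
      have "adm (lam * (y / lam * \<phi> r)) (\<lambda>t. lam * f (r * w t))"
        by (rule adm_nonlinearity[OF w, of _ r]) (use r fr lam in auto)
      then have "adm (\<phi> r * y) (\<lambda>t. lam * f (r * w t))" using lam by (simp add: mult.commute)
      then have "supnorm (sol (\<lambda>t. lam * f (r * w t))) \<le> L * I * q (\<phi> r * y)"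
        unfolding I_def by (rule supnorm_sol_upper)
      also have "\<dots> \<le> L * I * (q (\<phi> r) * p y)"
        using L_pos I r y \<phi>_nonneg by (intro mult_left_mono q_mult_le) auto
      also have "\<dots> = L * I * p y * r" by (simp add: q_inv)
      also have "\<dots> < 1 * r" using LIp r by (intro mult_strict_right_mono)
      finally show ?thesis by simp
    qed
    obtain r where r: "0 < r" "r < \<rho>" "\<forall>s\<in>{0..r}. f s \<le> y / lam * \<phi> r"
      using f_small[of "y / lam" \<rho>] y lam \<rho> by auto
    obtain R where R: "\<rho> < R" "\<forall>s\<in>{0..R}. f s \<le> y / lam * \<phi> R"
      using f_large[of "y / lam" \<rho>] y lam \<rho> by auto
    have "\<exists>u. solves lam u \<and> r < supnorm u \<and> supnorm u < \<rho>"
      by (rule solution_between[of lam r \<rho> "-1"]) (use lam r upper[OF r(1,3)] at_\<rho> in auto)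
    moreover have "\<exists>v. solves lam v \<and> \<rho> < supnorm v \<and> supnorm v < R"
      by (rule solution_between[of lam \<rho> R 1]) (use lam \<rho> R upper[OF _ R(2)] at_\<rho> in auto)
    ultimately show ?thesis using r(1) by (meson less_trans)
  qed
  then show ?thesis by (intro exI[of _ \<Lambda>]) (auto simp: \<Lambda>_def)
qed

end

subsection \<open>Branches of solutions\<close>

text \<open>The supremum may be infinite or not attained, so a maximiser is replaced by an element
  within 1 of every member, or above the cap \<open>b\<close> when the set is unbounded.\<close>

lemma almost_maximal:
  fixes S :: "real set"
  assumes "S \<noteq> {}"
  shows "\<exists>x\<in>S. \<forall>y\<in>S. min b (y - 1) \<le> x"
proof (cases "bdd_above S")
  case True
  then have "\<exists>x\<in>S. Sup S - 1 < x" using assms less_cSup_iff[of S "Sup S - 1"] by simp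
  then obtain x where "x \<in> S" "Sup S - 1 < x" by blast
  moreover have "y \<le> Sup S" if "y \<in> S" for y using cSup_upper[OF that True] .
  ultimately show ?thesis by (intro bexI[of _ x]) (auto simp: min_le_iff_disj intro: less_imp_le le_less_trans[OF diff_right_mono])
next
  case False
  then obtain x where "x \<in> S" "b < x" unfolding bdd_above_def by (meson not_le)
  then show ?thesis by (intro bexI[of _ x]) auto
qed

text \<open>Choosing an almost extremal solution for each \<open>lam\<close> makes a whole branch
  converge as soon as every target size is passed by some solution for all large \<open>lam\<close>.
  The base threshold serves as \<open>lams\<close>; existence also holds at the threshold
  itself.\<close>

lemma two_branches:
  fixes P :: "real \<Rightarrow> 'u \<Rightarrow> bool" and N :: "'u \<Rightarrow> real"
  assumes ex: "\<And>\<rho>. 0 < \<rho> \<Longrightarrow> \<exists>\<Lambda>>0. \<forall>lam\<ge>\<Lambda>. \<exists>u v. P lam u \<and> P lam v \<and> 0 < N u \<and> N u < \<rho> \<and> \<rho> < N v"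
  shows "\<exists>lams>0. \<exists>ms>0. \<exists>u1 u2.
           (\<forall>lam>lams. P lam (u1 lam) \<and> P lam (u2 lam) \<and>
              0 < N (u1 lam) \<and> N (u1 lam) < ms \<and> ms < N (u2 lam)) \<and>
           ((\<lambda>lam. N (u1 lam)) \<longlongrightarrow> 0) at_top \<and>
           filterlim (\<lambda>lam. N (u2 lam)) at_top at_top \<and> (\<exists>u. P lams u)"
proof -
  obtain l0 where l0: "0 < l0"
    and base: "\<And>lam. l0 \<le> lam \<Longrightarrow> \<exists>u v. P lam u \<and> P lam v \<and> 0 < N u \<and> N u < 1 \<and> 1 < N v"
    using ex[of 1] by auto
  define A1 where "A1 lam = {u. P lam u \<and> 0 < N u \<and> N u < 1}" for lam
  define A2 where "A2 lam = {u. P lam u \<and> 1 < N u}" for lam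
  have ne: "A1 lam \<noteq> {}" "A2 lam \<noteq> {}" if "l0 \<le> lam" for lam
    using base[OF that] by (auto simp: A1_def A2_def)
  \<comment> \<open>Norms are minimised by almost maximising their reciprocals, with
    \<open>lam\<close> itself as the cap.\<close>
  have "\<exists>u. l0 \<le> lam \<longrightarrow> u \<in> A1 lam \<and> (\<forall>v\<in>A1 lam. min lam (inverse (N v) - 1) \<le> inverse (N u))" for lam
    using almost_maximal[of "(\<lambda>u. inverse (N u)) ` A1 lam" lam] ne(1)[of lam] by auto
  then obtain u1 where u1: "\<And>lam. l0 \<le> lam \<Longrightarrow> u1 lam \<in> A1 lam"
    "\<And>lam v. l0 \<le> lam \<Longrightarrow> v \<in> A1 lam \<Longrightarrow> min lam (inverse (N v) - 1) \<le> inverse (N (u1 lam))"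
    by metis
  have "\<exists>u. l0 \<le> lam \<longrightarrow> u \<in> A2 lam \<and> (\<forall>v\<in>A2 lam. min lam (N v - 1) \<le> N u)" for lam
    using almost_maximal[of "N ` A2 lam" lam] ne(2)[of lam] by auto
  then obtain u2 where u2: "\<And>lam. l0 \<le> lam \<Longrightarrow> u2 lam \<in> A2 lam"
    "\<And>lam v. l0 \<le> lam \<Longrightarrow> v \<in> A2 lam \<Longrightarrow> min lam (N v - 1) \<le> N (u2 lam)"
    by metis
  have lim2: "filterlim (\<lambda>lam. N (u2 lam)) at_top at_top"
    unfolding filterlim_at_top
  proof
    fix Z :: real
    have "0 < \<bar>Z\<bar> + 2" by simp
    from ex[OF this] obtain \<Lambda> where \<Lambda>: "\<And>lam. \<Lambda> \<le> lam \<Longrightarrow> \<exists>v. P lam v \<and> \<bar>Z\<bar> + 2 < N v"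
      by metis
    have "Z \<le> N (u2 lam)" if lam: "max l0 (max \<Lambda> Z) \<le> lam" for lam
    proof -
      obtain v where v: "P lam v" "\<bar>Z\<bar> + 2 < N v" using \<Lambda>[of lam] lam by auto
      then have "v \<in> A2 lam" by (simp add: A2_def)
      then have "min lam (N v - 1) \<le> N (u2 lam)" using u2(2) lam by simp
      then show ?thesis using v lam by linarith
    qed
    then show "\<forall>\<^sub>F lam in at_top. Z \<le> N (u2 lam)" by (metis eventually_at_top_linorder)
  qed
  have "filterlim (\<lambda>lam. inverse (N (u1 lam))) at_top at_top"
    unfolding filterlim_at_top
  proof
    fix Z :: real
    have "0 < inverse (\<bar>Z\<bar> + 2)" by simp
    from ex[OF this] obtain \<Lambda> where \<Lambda>: "\<And>lam. \<Lambda> \<le> lam \<Longrightarrow> \<exists>v. P lam v \<and> 0 < N v \<and> N v < inverse (\<bar>Z\<bar> + 2)"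
      by metis
    have "Z \<le> inverse (N (u1 lam))" if lam: "max l0 (max \<Lambda> Z) \<le> lam" for lam
    proof -
      obtain v where v: "P lam v" "0 < N v" "N v < inverse (\<bar>Z\<bar> + 2)" using \<Lambda>[of lam] lam by auto
      have Z2: "\<bar>Z\<bar> + 2 < inverse (N v)" using less_imp_inverse_less[OF v(3,2)] by simp
      \<comment> \<open>This puts \<open>v\<close> below the separating value 1 and hence among the
        competitors \<open>A1 lam\<close>.\<close>
      have "inverse (\<bar>Z\<bar> + 2) \<le> 1" by (rule inverse_le_1_iff[THEN iffD2]) simp
      then have "v \<in> A1 lam" using v by (simp add: A1_def)
      then have "min lam (inverse (N v) - 1) \<le> inverse (N (u1 lam))" using u1(2) lam by simp
      then show ?thesis using Z2 lam by linarith
    qed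
    then show "\<forall>\<^sub>F lam in at_top. Z \<le> inverse (N (u1 lam))" by (metis eventually_at_top_linorder)
  qed
  from tendsto_inverse_0_at_top[OF this] have lim1: "((\<lambda>lam. N (u1 lam)) \<longlongrightarrow> 0) at_top" by simp
  have "\<forall>lam>l0. P lam (u1 lam) \<and> P lam (u2 lam) \<and> 0 < N (u1 lam) \<and> N (u1 lam) < 1 \<and> 1 < N (u2 lam)"
    using u1(1) u2(1) by (auto simp: A1_def A2_def)
  then show ?thesis
    using l0 lim1 lim2 base[of l0]
    by (intro exI[of _ l0] conjI exI[of _ "1::real"] exI[of _ u1] exI[of _ u2]) auto
qed

subsection \<open>The original problem\<close>

lemma inc_homeo_inverse:
  assumes "inc_homeo_nonneg \<psi>"
  defines "p \<equiv> the_inv_into {0..} \<psi>"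
  shows "\<And>y. 0 \<le> y \<Longrightarrow> 0 \<le> p y" "\<And>y. 0 \<le> y \<Longrightarrow> \<psi> (p y) = y" "\<And>x. 0 \<le> x \<Longrightarrow> p (\<psi> x) = x"
    "continuous_on {0..} p" "\<psi> 0 = 0" "\<And>x. 0 < x \<Longrightarrow> 0 < \<psi> x" "p 0 = 0" "\<And>y. 0 < y \<Longrightarrow> 0 < p y"
proof -
  have mono: "strict_mono_on {0..} \<psi>" and im: "\<psi> ` {0..} = {0..}"
    using assms by (auto simp: inc_homeo_nonneg_def)
  have inj: "inj_on \<psi> {0..}" using mono by (rule strict_mono_on_imp_inj_on)
  show p_nonneg: "0 \<le> p y" if "0 \<le> y" for y
    using the_inv_into_into[OF inj, of y "{0..}"] that im by (simp add: p_def)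
  show \<psi>p: "\<psi> (p y) = y" if "0 \<le> y" for y
    using f_the_inv_into_f[OF inj, of y] that im by (simp add: p_def)
  show p\<psi>: "p (\<psi> x) = x" if "0 \<le> x" for x
    using the_inv_into_f_f[OF inj, of x] that by (simp add: p_def)
  obtain x0 where x0: "0 \<le> x0" "\<psi> x0 = 0" using im by (metis atLeast_iff imageE order_refl)
  have \<psi>_nonneg: "0 \<le> \<psi> x" if "0 \<le> x" for x using im that by auto
  show \<psi>0: "\<psi> 0 = 0"
  proof (rule ccontr)
    assume "\<psi> 0 \<noteq> 0"
    then have "0 < x0" using x0 by (cases "x0 = 0") auto
    then have "\<psi> 0 < \<psi> x0" using strict_mono_onD[OF mono, of 0 x0] by simp
    then show False using x0(2) \<psi>_nonneg[of 0] by simp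
  qed
  show "0 < \<psi> x" if "0 < x" for x
    using strict_mono_onD[OF mono, of 0 x] that \<psi>0 by simp
  show p0: "p 0 = 0" using p\<psi>[of 0] \<psi>0 by simp
  show "0 < p y" if "0 < y" for y
    using p_nonneg[of y] \<psi>p[of y] \<psi>0 that by (cases "p y = 0") auto
  have p_mono: "p x \<le> p y" if "0 \<le> x" "x \<le> y" for x y
  proof (rule ccontr)
    assume "\<not> p x \<le> p y"
    then have "\<psi> (p y) < \<psi> (p x)"
      using strict_mono_onD[OF mono, of "p y" "p x"] p_nonneg that by auto
    then show False using \<psi>p that by auto
  qed
  \<comment> \<open>Extending \<open>p\<close> by the identity to the negative axis gives a monotone
    surjection of the line, whose continuity is immediate.\<close>
  define e where "e x = (if 0 \<le> x then p x else x)" for x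
  have "continuous_on UNIV e"
  proof (rule continuous_onI_mono)
    have "x \<in> range e" for x
    proof (cases "0 \<le> x")
      case True
      then show ?thesis using p\<psi>[OF True] \<psi>_nonneg[OF True]
        by (intro image_eqI[of _ _ "\<psi> x"]) (auto simp: e_def)
    next
      case False
      then show ?thesis by (intro image_eqI[of _ _ x]) (auto simp: e_def)
    qed
    then have "range e = UNIV" by blast
    then show "open (range e)" by simp
    show "e x \<le> e y" if "x \<le> y" for x y
      using that p_mono[of x y] p_nonneg[of y] by (auto simp: e_def)
  qed
  then show "continuous_on {0..} p"
    by (rule continuous_on_eq[OF continuous_on_subset]) (auto simp: e_def)
qed

text \<open>Taking the modulus of \<open>prim h\<close> merges the two integrals of the hypothesis,
  over the two open halves, into one integrand on the unit interval; finiteness of the Lebesgue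
  integral then gives gauge integrability.\<close>

lemma integrable_p_prim:
  assumes h: "continuous_on {0<..<1} h" "\<forall>t\<in>{0<..<1}. 0 \<le> h t"
    and psi: "inc_homeo_nonneg \<psi>" and int: "h_integrability \<psi> h"
  shows "(\<lambda>s. the_inv_into {0..} \<psi> \<bar>prim h s\<bar>) integrable_on {0..1}"
proof -
  define p where "p = the_inv_into {0..} \<psi>"
  note p_props = inc_homeo_inverse[OF psi, folded p_def]
  define g where "g s = p \<bar>prim h s\<bar>" for s
  have g_cont: "continuous_on {0<..<1} g"
    unfolding g_def
    by (rule continuous_on_compose2[OF p_props(4)]) (auto intro!: continuous_intros prim_continuous_on h(1))
  have g_meas: "(\<lambda>s. indicator A s *\<^sub>R g s) \<in> borel_measurable borel" if "A \<subseteq> {0<..<1}" "A \<in> sets borel" for A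
    using borel_measurable_continuous_on_indicator[OF that(2) continuous_on_subset[OF g_cont that(1)]] .
  have g_nonneg: "0 \<le> g s" for s using p_props(1) by (simp add: g_def)
  have nonneg: "0 \<le> integral {a..b} h" if "0 < a" "b < 1" for a b
    by (rule Henstock_Kurzweil_Integration.integral_nonneg)
      (use that h continuous_integrable_subinterval[OF h(1)] in auto)
  have left: "ennreal (p (integral {s..1/2} h)) * indicator {0<..<1/2} s
      = ennreal (indicator {0<..<1/2} s *\<^sub>R g s)" for s :: real
    using nonneg[of s "1/2"] by (auto simp: g_def prim_def indicator_def)
  have right: "ennreal (p (integral {1/2..s} h)) * indicator {1/2<..<1} s
      = ennreal (indicator {1/2<..<1} s *\<^sub>R g s)" for s :: real
    using nonneg[of "1/2" s] by (auto simp: g_def prim_def indicator_def)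
  have split: "ennreal (indicator {0<..<1} s *\<^sub>R g s)
      = ennreal (indicator {0<..<1/2} s *\<^sub>R g s) + ennreal (indicator {1/2<..<1} s *\<^sub>R g s)" for s
  proof (cases "s = 1/2")
    \<comment> \<open>The point 1/2 belongs to neither half, but the integrand vanishes there
      because \<open>p 0 = 0\<close>.\<close>
    case True
    show ?thesis unfolding True by (simp add: g_def p_props(7))
  qed (auto simp: indicator_def)
  have m: "(\<lambda>s. ennreal (indicator A s *\<^sub>R g s)) \<in> borel_measurable lborel"
    if "A \<subseteq> {0<..<1}" "A \<in> sets borel" for A
    using g_meas[OF that] by simp
  have "(\<integral>\<^sup>+ s. ennreal (indicator {0<..<1} s *\<^sub>R g s) \<partial>lborel) < \<infinity>"
  proof -
    have "(\<integral>\<^sup>+ s. ennreal (indicator {0<..<1/2} s *\<^sub>R g s) + ennreal (indicator {1/2<..<1} s *\<^sub>R g s) \<partial>lborel)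
        = (\<integral>\<^sup>+ s. ennreal (indicator {0<..<1/2} s *\<^sub>R g s) \<partial>lborel)
          + (\<integral>\<^sup>+ s. ennreal (indicator {1/2<..<1} s *\<^sub>R g s) \<partial>lborel)"
      by (rule nn_integral_add) (rule m; auto)+
    then show ?thesis
      using int unfolding h_integrability_def p_def[symmetric] left right split by simp
  qed
  then have "integrable lborel (\<lambda>s. indicator {0<..<1} s *\<^sub>R g s)"
    using g_meas[of "{0<..<1}"] g_nonneg
    by (intro integrableI_nonneg) auto
  then have "set_integrable lborel {0<..<1} g" by (simp add: set_integrable_def)
  then have "g integrable_on {0<..<1}" by (rule set_borel_integral_eq_integral(1))
  then show ?thesis by (simp add: g_def[abs_def] p_def integrable_on_open_interval_real)
qed

lemma continuous_pos_bounds: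
  fixes c :: "real \<Rightarrow> real"
  assumes "continuous_on {0..1} c" "\<forall>t\<in>{0..1}. c t > 0"
  obtains c0 c1 where "0 < c0" "0 < c1" "\<And>t. t \<in> {0..1} \<Longrightarrow> c0 \<le> c t \<and> c t \<le> c1"
proof -
  obtain x where x: "x \<in> {0..1}" "\<forall>y\<in>{0..1}. c x \<le> c y"
    using continuous_attains_inf[OF compact_Icc _ assms(1)] by auto
  obtain z where z: "z \<in> {0..1}" "\<forall>y\<in>{0..1}. c y \<le> c z"
    using continuous_attains_sup[OF compact_Icc _ assms(1)] by auto
  show ?thesis by (rule that[of "c x" "c z"]) (use x z assms(2) in auto)
qed

text \<open>Monotonicity of \<open>\<phi>\<close> turns the pointwise bound by
  \<open>e * \<phi> s\<close> into a bound over the whole interval by its value at the right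
  end.\<close>

lemma small_near_zero:
  fixes f \<phi> :: "real \<Rightarrow> real"
  assumes f: "continuous_on {0..} f" and \<phi>: "strict_mono \<phi>" "\<phi> 0 = 0"
    and f0: "((\<lambda>s. f s / \<phi> s) \<longlongrightarrow> 0) (at_right 0)" and e: "0 < e" "0 < \<rho>"
  shows "\<exists>r. 0 < r \<and> r < \<rho> \<and> (\<forall>s\<in>{0..r}. f s \<le> e * \<phi> r)"
proof -
  have \<phi>_pos: "0 < \<phi> s" if "0 < s" for s using strict_monoD[OF \<phi>(1) that] \<phi>(2) by simp
  have "\<forall>\<^sub>F s in at_right 0. f s / \<phi> s < e" using order_tendstoD(2)[OF f0 e(1)] .
  then obtain b where b: "0 < b" "\<And>s. 0 < s \<Longrightarrow> s < b \<Longrightarrow> f s / \<phi> s < e"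
    unfolding eventually_at_right_field by auto
  define r where "r = min b \<rho> / 2"
  have r: "0 < r" "r < \<rho>" "r < b" using b e by (auto simp: r_def)
  have pos: "f s \<le> e * \<phi> r" if "0 < s" "s \<le> r" for s
  proof -
    have "f s \<le> e * \<phi> s" using b(2)[of s] \<phi>_pos[of s] that r by (simp add: divide_less_eq)
    also have "\<dots> \<le> e * \<phi> r" using e(1) strict_mono_less_eq[OF \<phi>(1)] that by simp
    finally show ?thesis .
  qed
  \<comment> \<open>The limit hypothesis says nothing at 0 itself, so the bound is extended there by
    continuity.\<close>
  have "f 0 \<le> e * \<phi> r"
  proof (rule tendsto_upperbound)
    have "continuous (at 0 within {0..}) f" using f by (simp add: continuous_on_eq_continuous_within)
    then show "(f \<longlongrightarrow> f 0) (at_right 0)"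
      unfolding continuous_within by (rule tendsto_within_subset) auto
    show "\<forall>\<^sub>F s in at_right 0. f s \<le> e * \<phi> r"
      unfolding eventually_at_right_field using pos r(1) by (intro exI[of _ r]) auto
  qed simp
  then have "f s \<le> e * \<phi> r" if "s \<in> {0..r}" for s using pos[of s] that by (cases "s = 0") auto
  then show ?thesis using r by blast
qed

lemma small_near_infinity:
  fixes f \<phi> :: "real \<Rightarrow> real"
  assumes f: "continuous_on {0..} f" and \<phi>: "strict_mono \<phi>" "\<phi> 0 = 0" "surj \<phi>"
    and finf: "((\<lambda>s. f s / \<phi> s) \<longlongrightarrow> 0) at_top" and e: "0 < e" "0 < \<rho>"
  shows "\<exists>R>\<rho>. \<forall>s\<in>{0..R}. f s \<le> e * \<phi> R"
proof -
  have \<phi>_pos: "0 < \<phi> s" if "0 < s" for s using strict_monoD[OF \<phi>(1) that] \<phi>(2) by simp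
  have "\<forall>\<^sub>F s in at_top. f s / \<phi> s < e" using order_tendstoD(2)[OF finf e(1)] .
  then obtain b where b: "\<And>s. b \<le> s \<Longrightarrow> f s / \<phi> s < e"
    unfolding eventually_at_top_linorder by auto
  define b' where "b' = max b 1"
  have "compact (f ` {0..b'})"
    by (intro compact_continuous_image continuous_on_subset[OF f]) auto
  then have "bounded (f ` {0..b'})" by (rule compact_imp_bounded)
  then obtain B where B: "\<forall>y\<in>f ` {0..b'}. norm y \<le> B"
    unfolding bounded_iff by blast
  obtain R0 where R0: "B / e = \<phi> R0" using surjD[OF \<phi>(3)] by blast
  define R where "R = max (max R0 b') (\<rho> + 1)"
  have "f s \<le> e * \<phi> R" if s: "s \<in> {0..R}" for s
  proof (cases "s \<le> b'")
    case True
    have "f s \<in> f ` {0..b'}" using True s by auto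
    then have "\<bar>f s\<bar> \<le> B" using B by auto
    then have "f s \<le> e * \<phi> R0" using R0 e(1) by (simp flip: R0)
    also have "\<dots> \<le> e * \<phi> R" using e(1) strict_mono_less_eq[OF \<phi>(1)] by (simp add: R_def)
    finally show ?thesis .
  next
    case False
    then have "b \<le> s" "0 < s" by (auto simp: b'_def)
    then have "f s \<le> e * \<phi> s" using b[of s] \<phi>_pos[of s] by (simp add: divide_less_eq)
    also have "\<dots> \<le> e * \<phi> R" using e(1) strict_mono_less_eq[OF \<phi>(1)] s by simp
    finally show ?thesis .
  qed
  moreover have "\<rho> < R" by (simp add: R_def less_max_iff_disj)
  ultimately show ?thesis by blast
qed

theorem theorem3p7:
  fixes \<phi> \<psi>1 \<psi>2 c d f h :: "real \<Rightarrow> real"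
  assumes phi: "phi_condA \<phi> \<psi>1 \<psi>2"
    and c: "continuous_on {0..1} c" "\<forall>t\<in>{0..1}. c t > 0"
    and d: "continuous_on {0..1} d" "\<forall>t\<in>{0..1}. d t > 0"
    and f: "continuous_on {0..} f" "\<forall>s\<ge>0. f s \<ge> 0" "\<forall>s>0. f s > 0"
    and h: "continuous_on {0<..<1} h" "\<forall>t\<in>{0<..<1}. h t \<ge> 0" "\<exists>t\<in>{0<..<1}. h t \<noteq> 0"
    and h_int: "h_integrability \<psi>1 h"
    and h_pts: "0 \<le> alpha_h h" "alpha_h h < gamma1_h h" "gamma1_h h < gamma2_h h"
               "gamma2_h h < beta_h h" "beta_h h \<le> 1"
    and f0: "((\<lambda>s. f s / \<phi> s) \<longlongrightarrow> 0) (at_right 0)"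
    and finf: "((\<lambda>s. f s / \<phi> s) \<longlongrightarrow> 0) at_top"
  shows "\<exists>lams>0. \<exists>ms>0. \<exists>u1 u2 :: real \<Rightarrow> real \<Rightarrow> real.
           (\<forall>lam>lams. is_pos_solution \<phi> c d h f lam (u1 lam) \<and> is_pos_solution \<phi> c d h f lam (u2 lam) \<and>
                     0 < supnorm (u1 lam) \<and> supnorm (u1 lam) < ms \<and> ms < supnorm (u2 lam)) \<and>
           ((\<lambda>lam. supnorm (u1 lam)) \<longlongrightarrow> 0) at_top \<and>
           filterlim (\<lambda>lam. supnorm (u2 lam)) at_top at_top \<and>
           (\<exists>u. is_pos_solution \<phi> c d h f lams u)"
proof -
  define q where "q = inv \<phi>"
  define p where "p = the_inv_into {0..} \<psi>1"
  have \<phi>_odd: "\<And>x. \<phi> (- x) = - \<phi> x"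
    and \<phi>_mono: "strict_mono \<phi>" and \<phi>_surj: "surj \<phi>" and psi: "inc_homeo_nonneg \<psi>1"
    and \<phi>_mult: "\<And>x y. 0 \<le> x \<Longrightarrow> 0 \<le> y \<Longrightarrow> \<phi> x * \<psi>1 y \<le> \<phi> (x * y)"
    using phi by (auto simp: phi_condA_def)
  note p_props = inc_homeo_inverse[OF psi, folded p_def]
  have \<phi>0: "\<phi> 0 = 0" using \<phi>_odd[of 0] by simp
  have \<phi>q: "\<phi> (q x) = x" for x using \<phi>_surj by (simp add: q_def surj_f_inv_f)
  have q\<phi>: "q (\<phi> x) = x" for x
    using \<phi>_mono by (simp add: q_def inv_f_f strict_mono_imp_inj_on)
  have q_mono: "strict_mono q"
    by (rule strict_monoI) (metis \<phi>q \<phi>_mono strict_mono_less)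
  have q_odd: "q (- x) = - q x" for x using q\<phi>[of "- q x"] by (simp add: \<phi>_odd \<phi>q)
  have q_cont: "continuous_on UNIV q"
  proof (rule continuous_onI_mono)
    have "range q = UNIV" using q\<phi> by (metis surjI)
    then show "open (range q)" by simp
    show "q x \<le> q y" if "x \<le> y" for x y using that q_mono by (simp add: strict_mono_less_eq)
  qed
  have q_nonneg: "0 \<le> q x" if "0 \<le> x" for x
    using strict_mono_less_eq[OF q_mono, of 0 x] q_odd[of 0] that by simp
  have q_mult: "q (x * y) \<le> q x * p y" if "0 \<le> x" "0 \<le> y" for x y
  proof -
    \<comment> \<open>The left inequality of condition (A), taken at \<open>q x\<close> and
      \<open>p y\<close>, becomes an upper bound after applying the monotone inverse.\<close>
    have "x * y = \<phi> (q x) * \<psi>1 (p y)" using that p_props(2) by (simp add: \<phi>q)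
    also have "\<dots> \<le> \<phi> (q x * p y)" using that q_nonneg p_props(1) by (intro \<phi>_mult) auto
    finally have "q (x * y) \<le> q (\<phi> (q x * p y))" using q_mono by (simp add: strict_mono_less_eq)
    then show ?thesis by (simp add: q\<phi>)
  qed
  obtain c0 c1 where c01: "0 < c0" "0 < c1" "\<And>t. t \<in> {0..1} \<Longrightarrow> c0 \<le> c t \<and> c t \<le> c1"
    by (rule continuous_pos_bounds[OF c]) blast
  obtain d0 d1 where d01: "0 < d0" "0 < d1" "\<And>t. t \<in> {0..1} \<Longrightarrow> d0 \<le> d t \<and> d t \<le> d1"
    by (rule continuous_pos_bounds[OF d]) blast
  define a where "a t v = q (v / d t) / c t" for t v
  \<comment> \<open>Writing \<open>v\<close> as \<open>v / d t * d t\<close> with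
    \<open>d t \<le> d1\<close> gives \<open>q v \<le> q (v / d t) * p d1\<close>, hence
    \<open>l\<close>; writing \<open>v / d t \<le> v * (1 / d0)\<close> gives
    \<open>L\<close>.\<close>
  define l where "l = 1 / (p d1 * c1)"
  define L where "L = p (1 / d0) / c0"
  have c_pos: "0 < c t" and d_pos: "0 < d t" if "t \<in> {0<..<1}" for t using c(2) d(2) that by auto
  have bounds: "l * q v \<le> a t v \<and> a t v \<le> L * q v" if t: "t \<in> {0<..<1}" and v: "0 \<le> v" for t v
  proof
    have t': "t \<in> {0..1}" using t by auto
    have "q v \<le> q (v / d t * d1)"
      using d01(3)[OF t'] d_pos[OF t] v q_mono mult_left_mono[of "d t" d1 "v / d t"]
      by (simp add: strict_mono_less_eq)
    also have "\<dots> \<le> q (v / d t) * p d1" using v d_pos[OF t] d01 by (intro q_mult) auto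
    finally have *: "q v / p d1 \<le> q (v / d t)" using p_props(8)[OF d01(2)] by (simp add: divide_le_eq)
    have "l * q v = q v / p d1 / c1" by (simp add: l_def)
    also have "\<dots> \<le> q v / p d1 / c t"
      using c01(3)[OF t'] c_pos[OF t] c01(2) p_props(8)[OF d01(2)] q_nonneg[OF v]
      by (intro divide_left_mono) auto
    also have "\<dots> \<le> a t v" unfolding a_def using * c_pos[OF t] by (intro divide_right_mono) auto
    finally show "l * q v \<le> a t v" .
    have "q (v / d t) \<le> q (v * (1 / d0))"
      using d01(3)[OF t'] d01(1) v q_mono by (simp add: strict_mono_less_eq frac_le)
    also have "\<dots> \<le> q v * p (1 / d0)" using v d01(1) by (intro q_mult) auto
    finally have "a t v \<le> q v * p (1 / d0) / c t"
      unfolding a_def using c_pos[OF t] by (intro divide_right_mono) auto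
    also have "\<dots> \<le> q v * p (1 / d0) / c0"
      using c01 c01(3)[OF t'] c_pos[OF t] q_nonneg[OF v] p_props(1)[of "1 / d0"] d01(1)
      by (intro divide_left_mono mult_nonneg_nonneg) auto
    finally show "a t v \<le> L * q v" by (simp add: L_def mult.commute)
  qed
  interpret bvp_problem a q p h l L f
  proof
    show "\<exists>x. y \<le> q x" for y using q\<phi>[of y] by (metis order_refl)
    show "continuous_on ({0<..<1} \<times> UNIV) (\<lambda>(t, v). a t v)"
      unfolding a_def case_prod_unfold
    proof (intro continuous_on_divide continuous_on_compose2[OF q_cont])
      have "continuous_on {0<..<1} c" "continuous_on {0<..<1} d"
        by (rule continuous_on_subset[OF c(1)] continuous_on_subset[OF d(1)]; auto)+
      then show "continuous_on ({0<..<1} \<times> UNIV) (\<lambda>x. c (fst x))" "continuous_on ({0<..<1} \<times> UNIV) (\<lambda>x. d (fst x))"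
        by (auto intro!: continuous_on_compose2[of "{0<..<1}" c] continuous_on_compose2[of "{0<..<1}" d]
              continuous_on_fst continuous_on_id)
    qed (use c_pos d_pos in \<open>force intro!: continuous_intros\<close>)+
    show "a t (- v) = - a t v" for t v by (simp add: a_def q_odd)
    show "a t v < a t w" if "t \<in> {0<..<1}" "v < w" for t v w
      using that c_pos d_pos q_mono
      by (simp add: a_def divide_strict_right_mono strict_mono_less)
    show "0 < l" using p_props(8)[OF d01(2)] c01(2) by (simp add: l_def)
    show "(\<lambda>s. p \<bar>prim h s\<bar>) integrable_on {0..1}"
      unfolding p_def by (rule integrable_p_prim[OF h(1,2) psi h_int])
  qed (use q_odd q_mono q_mult p_props(1) bounds h f in auto)
  have pos_solution: "is_pos_solution \<phi> c d h f lam u" if "solves lam u" for lam u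
  proof -
    obtain M k where k: "adm M k" and u: "u = sol k" and k_eq: "\<forall>t\<in>{0..1}. k t = lam * f (u t)"
      and pos: "\<forall>t\<in>{0<..<1}. 0 < u t"
      using \<open>solves lam u\<close> by (auto simp: solves_def)
    let ?g = "\<lambda>s. h s * k s"
    \<comment> \<open>Applying \<open>\<phi>\<close> to \<open>c t\<close> times the derivative
      undoes \<open>a\<close>, so the flux is an explicit primitive and its derivative is the
      right-hand side of the equation.\<close>
    have flux: "d t * \<phi> (c t * ker k (kap k) t) = kap k - prim ?g t" if "t \<in> {0<..<1}" for t
      using c_pos[OF that] d_pos[OF that] by (simp add: ker_def a_def \<phi>q)
    have flux_deriv: "((\<lambda>s. d s * \<phi> (c s * ker k (kap k) s)) has_real_derivative - ?g t) (at t)"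
      if t: "t \<in> {0<..<1}" for t
    proof -
      have "((\<lambda>s. kap k - prim ?g s) has_real_derivative - ?g t) (at t)"
        by (auto intro!: derivative_eq_intros prim_has_real_derivative adm_cont[OF k] t)
      then show ?thesis
        by (rule has_field_derivative_transform_within_open[of _ _ _ "{0<..<1}"]) (use t flux in auto)
    qed
    have "continuous_on {0<..<1} (\<lambda>t. - ?g t)" by (intro continuous_intros adm_cont[OF k])
    then have "is_solution \<phi> c d h f lam u"
      unfolding is_solution_def u
      using sol_continuous_on[OF k] sol_has_real_derivative[OF k] ker_cont[OF k] flux_deriv
        sol_1[OF k] k_eq u
      by (intro conjI exI[of _ "ker k (kap k)"] exI[of _ "\<lambda>t. - ?g t"]) auto
    then show ?thesis using pos by (simp add: is_pos_solution_def)
  qed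
  have "\<exists>\<Lambda>>0. \<forall>lam\<ge>\<Lambda>. \<exists>u v. is_pos_solution \<phi> c d h f lam u \<and> is_pos_solution \<phi> c d h f lam v \<and>
      0 < supnorm u \<and> supnorm u < \<rho> \<and> \<rho> < supnorm v" if "0 < \<rho>" for \<rho>
  proof -
    have "\<exists>\<Lambda>>0. \<forall>lam\<ge>\<Lambda>. \<exists>u v. solves lam u \<and> solves lam v \<and>
        0 < supnorm u \<and> supnorm u < \<rho> \<and> \<rho> < supnorm v"
    proof (rule two_solutions[of \<phi>])
      show "0 \<le> \<phi> x" if "0 \<le> x" for x
        using strict_mono_less_eq[OF \<phi>_mono, of 0 x] \<phi>0 that by simp
      \<comment> \<open>The witness \<open>\<psi>1 (e / 2)\<close> has image \<open>e / 2\<close>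
        under \<open>p\<close>.\<close>
      show "\<exists>y>0. p y < e" if "0 < e" for e
        using p_props(6)[of "e / 2"] p_props(3)[of "e / 2"] that by (intro exI[of _ "\<psi>1 (e / 2)"]) auto
      show "\<exists>r. 0 < r \<and> r < \<rho> \<and> (\<forall>s\<in>{0..r}. f s \<le> e * \<phi> r)" if "0 < e" "0 < \<rho>" for e \<rho>
        by (rule small_near_zero[OF f(1) \<phi>_mono \<phi>0 f0 that])
      show "\<exists>R>\<rho>. \<forall>s\<in>{0..R}. f s \<le> e * \<phi> R" if "0 < e" "0 < \<rho>" for e \<rho>
        by (rule small_near_infinity[OF f(1) \<phi>_mono \<phi>0 \<phi>_surj finf that])
    qed (use q\<phi> that in auto)
    then show ?thesis using pos_solution by meson
  qed
  then show ?thesis by (rule two_branches)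
qed

end
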